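(* Under partial information feedback, the OGD-CB algorithm $\beta$ guarantees \[\liminf_{T\to\infty,\ B=\rho T}\ \inf_{\bm v,\,G}\ \frac1T\,\mathbb E_{\bm p\sim G^T}\Big[R^\beta(\bm v,\bm p)-\frac{\rho}{\bar v}\,R^{\mathrm H}(\bm v,\bm p)\Big]\ \ge 0,\] where the infimum is over value sequences $\bm v\in[0,\bar v]^T$ and distributions $G$ on $[0,\bar v]$.
   Context: Model: constants $\bar v>0$, $\rho\in(0,\bar v]$; $T$ rounds; budget $B=\rho T$. Round $t$: value $v_t\in[0,\bar v]$ (an arbitrary, adversarial sequence); highest competing bid $p_t$ i.i.d. from an unknown distribution $G$ on $[0,\bar v]$. Buyer chooses $x_t\in\{0,1\}$, receives $x_tr_t$ with $r_t=(v_t-p_t)^+$, pays $x_tc_t$ with $c_t=p_t\mathbf 1[v_t\ge p_t]$. Partial information: $p_t$ observed only when $x_t=1$. Revenue $R^\beta(\bm v,\bm p)=\sum_{t=1}^{T_0}x_tr_t$, $T_0$ the ending time. Hindsight benchmark: $R^{\mathrm H}(\bm v,\bm p)=\max_{\bm x\in\{0,1\}^T}\sum_tx_t(v_t-p_t)^+$ s.t. $\sum_tx_tp_t\mathbf 1[v_t\ge p_t]\le T\rho$. OGD-CB algorithm: $\mathcal I_1=\emptyset$, $B_1=B$, $\lambda_1=0$. For $t=1,\dots,T$: observe $v_t$. If $t=1$: $x_1=1$, $\lambda_2=\lambda_1$. Otherwise: $\epsilon_t=\sqrt{(\ln 2+2\ln T)/(2|\mathcal I_t|)}$; $\tilde r_t(v)=\frac1{|\mathcal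 I_t|}\sum_{\tau\in\mathcal I_t}(v-p_\tau)^++\epsilon_tv$; $\tilde c_t(v)=\frac1{|\mathcal I_t|}\sum_{\tau\in\mathcal I_t}p_\tau\mathbf 1[v\ge p_\tau]-2\epsilon_tv$; $x_t=\mathbf 1[\tilde r_t(v_t)\ge\lambda_t\tilde c_t(v_t)]$; $\eta_t=1/(\bar v\sqrt t)$; $\lambda_{t+1}=(\lambda_t+\eta_t(x_t\tilde c_t(v_t)-\rho))^+$. If $x_t=1$, observe $p_t$ and set $\mathcal I_{t+1}=\mathcal I_t\cup\{t\}$, else $\mathcal I_{t+1}=\mathcal I_t$. Set $B_{t+1}=B_t-x_tc_t$; if $B_{t+1}<\bar v$, stop; $T_0$ is the stopping round (or $T$). *)

theory Defs
  imports "HOL-Probability.Probability"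
begin

text \<open>Rounds are indexed t = 1..T. Values v and competing bids p are sequences nat => real;
only indices 1..T matter.\<close>

definition reward :: "real \<Rightarrow> real \<Rightarrow> real" where
  "reward v p = max 0 (v - p)"

definition cost :: "real \<Rightarrow> real \<Rightarrow> real" where
  "cost v p = (if v \<ge> p then p else 0)"

record ogd_state =
  obs :: "nat set"      (* the index set I_t of rounds whose p was observed *)
  budget :: real
  lam :: real
  rev :: real
  stopped :: bool

definition ogd_step ::
  "real \<Rightarrow> real \<Rightarrow> nat \<Rightarrow> (nat \<Rightarrow> real) \<Rightarrow> (nat \<Rightarrow> real) \<Rightarrow> nat \<Rightarrow> ogd_state \<Rightarrow> ogd_state" where
  "ogd_step vbar \<rho> T v p t s =
    (if stopped s then s else
     let I = obs s;
         n = real (card I);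
         \<epsilon> = sqrt ((ln 2 + 2 * ln (real T)) / (2 * n));
         rt = (\<Sum>\<tau>\<in>I. reward (v t) (p \<tau>)) / n + \<epsilon> * v t;
         ct = (\<Sum>\<tau>\<in>I. cost (v t) (p \<tau>)) / n - 2 * \<epsilon> * v t;
         x = (if t = 1 then True else rt \<ge> lam s * ct);
         \<eta> = 1 / (vbar * sqrt (real t));
         lam' = (if t = 1 then lam s
                 else max 0 (lam s + \<eta> * ((if x then ct else 0) - \<rho>)));
         I' = (if x then I \<union> {t} else I);
         B' = budget s - (if x then cost (v t) (p t) else 0);
         R' = rev s + (if x then reward (v t) (p t) else 0)
     in \<lparr>obs = I', budget = B', lam = lam', rev = R', stopped = (B' < vbar)\<rparr>)"

fun ogd_run ::
  "real \<Rightarrow> real \<Rightarrow> nat \<Rightarrow> (nat \<Rightarrow> real) \<Rightarrow> (nat \<Rightarrow> real) \<Rightarrow> nat \<Rightarrow> ogd_state" where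
  "ogd_run vbar \<rho> T v p 0 =
     \<lparr>obs = {}, budget = \<rho> * real T, lam = 0, rev = 0, stopped = False\<rparr>"
| "ogd_run vbar \<rho> T v p (Suc k) = ogd_step vbar \<rho> T v p (Suc k) (ogd_run vbar \<rho> T v p k)"

definition ogd_revenue ::
  "real \<Rightarrow> real \<Rightarrow> nat \<Rightarrow> (nat \<Rightarrow> real) \<Rightarrow> (nat \<Rightarrow> real) \<Rightarrow> real" where
  "ogd_revenue vbar \<rho> T v p = rev (ogd_run vbar \<rho> T v p T)"

text \<open>R^H(v,p): hindsight optimum; a decision vector x in {0,1}^T is represented by
the set S of rounds with x_t = 1.\<close>
definition hindsight :: "real \<Rightarrow> nat \<Rightarrow> (nat \<Rightarrow> real) \<Rightarrow> (nat \<Rightarrow> real) \<Rightarrow> real" where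
  "hindsight \<rho> T v p =
     Max ((\<lambda>S. \<Sum>t\<in>S. reward (v t) (p t)) `
          {S. S \<subseteq> {1..T} \<and> (\<Sum>t\<in>S. cost (v t) (p t)) \<le> real T * \<rho>})"

definition admissible :: "real \<Rightarrow> nat \<Rightarrow> (nat \<Rightarrow> real) \<Rightarrow> real measure \<Rightarrow> bool" where
  "admissible vbar T v G \<longleftrightarrow>
     (\<forall>t\<in>{1..T}. v t \<in> {0..vbar}) \<and>
     prob_space G \<and> sets G = sets borel \<and> emeasure G {0..vbar} = 1"

definition normalized_gap ::
  "real \<Rightarrow> real \<Rightarrow> nat \<Rightarrow> (nat \<Rightarrow> real) \<Rightarrow> real measure \<Rightarrow> real" where
  "normalized_gap vbar \<rho> T v G =
     (1 / real T) * (\<integral>p. ogd_revenue vbar \<rho> T v p - (\<rho> / vbar) * hindsight \<rho> T v p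
                        \<partial>(PiM {1..T} (\<lambda>_. G)))"

end

theory Submission
  imports Defs "HOL-Real_Asymp.Real_Asymp"
begin

text \<open>
  Up to the bad events below, the estimates are optimistic (reward above, cost below its mean) with
  width \<open>O(\<epsilon>\<^sub>t)\<close>. The widths are incurred only in rounds that add an observation, so
  they sum to \<open>O(sqrt (T ln T))\<close>. The chosen action maximises the estimated Lagrangian;
  comparing it with playing with probability \<open>q = \<rho> / vbar\<close>, whose expected payment never
  exceeds \<open>\<rho>\<close>, gives
  \<open>x\<^sub>t r\<^sub>t \<ge> q r\<^sub>t + \<lambda>\<^sub>t (x\<^sub>t c\<^sub>t - \<rho>)\<close>
  for the estimates. By the regret bound of gradient descent, \<open>\<lambda>\<^sub>t\<close> may be replaced by a
  fixed \<open>\<lambda>\<close> at cost \<open>O(sqrt T ln T)\<close>. If the budget never runs out take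
  \<open>\<lambda> = 0\<close>; otherwise \<open>\<lambda> = 1\<close>, and the overspending \<open>\<rho> (T - T\<^sub>0)\<close>
  pays for the reward \<open>q vbar\<close> lost in each round after stopping. The hindsight optimum is bounded
  by the sum of all rewards.

  All rounds are indexed from 0 below: index \<open>k\<close> stands for round \<open>Suc k\<close>.
\<close>

section \<open>Predictable play against i.i.d. bids\<close>

locale iid_bids = G: prob_space G for G :: "real measure" +
  fixes T :: nat
  assumes sets_G [measurable_cong]: "sets G = sets borel"
begin

section \<open>Product space of bids and Fubini in a single coordinate\<close>

definition M :: "(nat \<Rightarrow> real) measure" where
  "M = PiM {1..T} (\<lambda>_. G)"

sublocale M: prob_space M
  unfolding M_def by (intro prob_space_PiM G.prob_space_axioms)

sublocale P: product_prob_space "\<lambda>_::nat. G"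
  by unfold_locales

lemma measurable_bid [measurable]: "i \<in> {1..T} \<Longrightarrow> (\<lambda>p. p i) \<in> borel_measurable M"
  unfolding M_def by (subst measurable_cong_sets[OF refl sets_G[symmetric]])
    (rule measurable_component_singleton)

lemma borel_measurable_G: "f \<in> borel_measurable borel \<Longrightarrow> f \<in> borel_measurable G"
  by (subst measurable_cong_sets[OF sets_G refl])

lemma AE_bid: "i \<in> {1..T} \<Longrightarrow> AE y in G. P y \<Longrightarrow> AE p in M. P (p i)"
  unfolding M_def by (rule AE_PiM_component) (auto intro: G.prob_space_axioms)

text \<open>Fubini with coordinate \<open>i\<close> integrated last: the inner integral no longer
  depends on the old \<open>p i\<close>, and \<open>G\<close> has mass 1. This stands in for
  conditioning on all bids except bid \<open>i\<close>.\<close>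

lemma nn_integral_resample:
  assumes i: "i \<in> {1..T}" and f: "f \<in> borel_measurable M"
  shows "(\<integral>\<^sup>+p. f p \<partial>M) = (\<integral>\<^sup>+p. (\<integral>\<^sup>+y. f (p(i := y)) \<partial>G) \<partial>M)"
proof -
  define J where "J = {1..T} - {i}"
  have J: "finite J" "i \<notin> J" "{1..T} = insert i J" using i by (auto simp: J_def)
  have M: "M = PiM (insert i J) (\<lambda>_. G)" unfolding M_def J(3) ..
  have f': "f \<in> borel_measurable (PiM (insert i J) (\<lambda>_. G))" using f by (simp add: M)
  have upd: "(\<lambda>w. (fst w)(i := snd w)) \<in> M \<Otimes>\<^sub>M G \<rightarrow>\<^sub>M M"
    unfolding M by (rule measurable_PiM_single') (auto simp: space_PiM space_pair_measure PiE_iff extensional_def)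
  have F: "(\<lambda>p. \<integral>\<^sup>+y. f (p(i := y)) \<partial>G) \<in> borel_measurable M"
    using measurable_compose[OF upd f]
    by (intro G.borel_measurable_nn_integral) (simp add: case_prod_beta')
  have "(\<integral>\<^sup>+p. (\<integral>\<^sup>+y. f (p(i := y)) \<partial>G) \<partial>M)
      = (\<integral>\<^sup>+p. (\<integral>\<^sup>+z. (\<integral>\<^sup>+y. f ((p(i := z))(i := y)) \<partial>G) \<partial>G) \<partial>PiM J (\<lambda>_. G))"
    unfolding M by (rule P.product_nn_integral_insert[OF J(1,2)]) (use F M in simp)
  also have "\<dots> = (\<integral>\<^sup>+p. (\<integral>\<^sup>+y. f (p(i := y)) \<partial>G) \<partial>PiM J (\<lambda>_. G))"
    by (simp add: G.emeasure_space_1)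
  also have "\<dots> = (\<integral>\<^sup>+p. f p \<partial>M)"
    unfolding M by (rule P.product_nn_integral_insert[OF J(1,2) f', symmetric])
  finally show ?thesis ..
qed

text \<open>A factor that ignores coordinate \<open>i\<close> is independent of bid
  \<open>i\<close>, so the product splits. With a centred \<open>f\<close> this is orthogonality of
  martingale increments.\<close>

lemma integral_predictable_mult:
  fixes A :: "(nat \<Rightarrow> real) \<Rightarrow> real" and f :: "real \<Rightarrow> real"
  assumes i: "i \<in> {1..T}" and inv: "\<And>p y. A (p(i := y)) = A p"
    and A: "integrable M A" and Af: "integrable M (\<lambda>p. A p * f (p i))"
  shows "(\<integral>p. A p * f (p i) \<partial>M) = (\<integral>p. A p \<partial>M) * (\<integral>y. f y \<partial>G)"
proof -
  define J where "J = {1..T} - {i}"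
  have J: "finite J" "i \<notin> J" "{1..T} = insert i J" using i by (auto simp: J_def)
  have M: "M = PiM (insert i J) (\<lambda>_. G)" unfolding M_def J(3) ..
  have "(\<integral>p. A p * f (p i) \<partial>M) = (\<integral>p. (\<integral>y. A (p(i := y)) * f ((p(i := y)) i) \<partial>G) \<partial>PiM J (\<lambda>_. G))"
    unfolding M by (rule P.product_integral_insert[OF J(1,2)]) (use Af M in simp)
  also have "\<dots> = (\<integral>p. A p \<partial>PiM J (\<lambda>_. G)) * (\<integral>y. f y \<partial>G)"
    by (simp add: inv)
  also have "(\<integral>p. A p \<partial>PiM J (\<lambda>_. G)) = (\<integral>p. (\<integral>y. A (p(i := y)) \<partial>G) \<partial>PiM J (\<lambda>_. G))"
    by (simp add: inv G.prob_space)
  also have "\<dots> = (\<integral>p. A p \<partial>M)"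
    unfolding M by (rule P.product_integral_insert[OF J(1,2), symmetric]) (use A M in simp)
  finally show ?thesis .
qed

end

text \<open>Predictability is phrased as invariance under overwriting later coordinates, which
  avoids filtrations. Decision \<open>x k\<close> belongs to round \<open>Suc k\<close>: it may
  depend on bids up to index \<open>k\<close>, but not on the bid of its own round.\<close>

locale predictable_play = iid_bids +
  fixes x :: "nat \<Rightarrow> (nat \<Rightarrow> real) \<Rightarrow> bool"
  assumes x_measurable [measurable]: "k < T \<Longrightarrow> Measurable.pred M (x k)"
    and x_predictable: "k < i \<Longrightarrow> x k (p(i := y)) = x k p"
begin

section \<open>Observation counts, deviation sums and their concentration\<close>

definition plays :: "nat \<Rightarrow> (nat \<Rightarrow> real) \<Rightarrow> real" where
  "plays k p = (\<Sum>j<k. of_bool (x j p))"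

text \<open>With \<open>m\<close> the mean of \<open>f\<close>, this is a martingale: each increment
  is a centred bid switched on or off by a predictable decision.\<close>

definition dev :: "(real \<Rightarrow> real) \<Rightarrow> real \<Rightarrow> nat \<Rightarrow> (nat \<Rightarrow> real) \<Rightarrow> real" where
  "dev f m k p = (\<Sum>j<k. of_bool (x j p) * (f (p (Suc j)) - m))"

lemma plays_predictable: "k \<le> i \<Longrightarrow> plays k (p(i := y)) = plays k p"
  by (auto simp: plays_def x_predictable intro!: sum.cong)

lemma dev_predictable: "k < i \<Longrightarrow> dev f m k (p(i := y)) = dev f m k p"
  by (auto simp: dev_def x_predictable intro!: sum.cong)

lemma plays_measurable [measurable]: "k \<le> T \<Longrightarrow> plays k \<in> borel_measurable M"
  unfolding plays_def[abs_def] by measurable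

lemma dev_measurable [measurable]:
  assumes "k \<le> T" and [measurable]: "f \<in> borel_measurable borel"
  shows "dev f m k \<in> borel_measurable M"
  unfolding dev_def[abs_def]
proof (rule borel_measurable_sum)
  fix j assume "j \<in> {..<k}"
  then have [measurable]: "(\<lambda>p. p (Suc j)) \<in> borel_measurable M" "Measurable.pred M (x j)"
    using assms by auto
  show "(\<lambda>p. of_bool (x j p) * (f (p (Suc j)) - m)) \<in> borel_measurable M" by measurable
qed

lemma plays_nat: "\<exists>n\<le>k. plays k p = real n"
proof -
  have "plays k p = real (card {j\<in>{..<k}. x j p})"
    by (simp add: plays_def of_bool_def sum.If_cases Int_def)
  moreover have "card {j\<in>{..<k}. x j p} \<le> k"
    using card_mono[of "{..<k}" "{j\<in>{..<k}. x j p}"] by auto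
  ultimately show ?thesis by blast
qed

lemma plays_nonneg: "0 \<le> plays k p"
  by (simp add: plays_def sum_nonneg)

lemma plays_mono: "k \<le> l \<Longrightarrow> plays k p \<le> plays l p"
  unfolding plays_def by (intro sum_mono2) auto

text \<open>The integrand is a supermartingale. A played round multiplies it by a factor that
  Hoeffding's lemma bounds by 1 in mean; an unplayed round leaves it unchanged. The compensator
  therefore runs with \<open>plays\<close>, not with the number of rounds.\<close>

lemma dev_exp_moment:
  assumes "k \<le> T" and [measurable]: "f \<in> borel_measurable borel"
    and bnd: "AE y in G. f y \<in> {a..b}" and l: "0 < l"
  defines "m \<equiv> \<integral>y. f y \<partial>G"
  shows "(\<integral>\<^sup>+p. ennreal (exp (l * dev f m k p - l\<^sup>2 * (b - a)\<^sup>2 / 8 * plays k p)) \<partial>M) \<le> 1"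
  using assms(1)
proof (induction k)
  case 0
  then show ?case by (simp add: dev_def plays_def M.emeasure_space_1)
next
  case (Suc k)
  define E where "E k p = exp (l * dev f m k p - l\<^sup>2 * (b - a)\<^sup>2 / 8 * plays k p)" for k p
  have [measurable]: "dev f m k \<in> borel_measurable M" "plays k \<in> borel_measurable M"
    "dev f m (Suc k) \<in> borel_measurable M" "plays (Suc k) \<in> borel_measurable M"
    using Suc.prems by (auto intro!: dev_measurable plays_measurable)
  have [measurable]: "E k \<in> borel_measurable M" "E (Suc k) \<in> borel_measurable M"
    unfolding E_def by measurable
  have [measurable]: "f \<in> borel_measurable G" by (rule borel_measurable_G) fact
  \<comment> \<open>Centring shifts the interval but keeps its length \<open>b - a\<close>, which is
    all that enters the Hoeffding bound.\<close>
  interpret f: interval_bounded_random_variable G "\<lambda>y. f y - m" "a - m" "b - m"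
    by unfold_locales (use bnd in \<open>auto\<close>)
  have "integrable G f"
  proof (rule G.integrable_const_bound[of _ "max \<bar>a\<bar> \<bar>b\<bar>"])
    show "AE y in G. norm (f y) \<le> max \<bar>a\<bar> \<bar>b\<bar>" using bnd by eventually_elim auto
  qed measurable
  then have m0: "G.expectation (\<lambda>y. f y - m) = 0"
    by (simp add: m_def G.prob_space)
  have H: "(\<integral>\<^sup>+y. ennreal (exp (l * (f y - m))) \<partial>G) \<le> ennreal (exp (l\<^sup>2 * (b - a)\<^sup>2 / 8))"
    using f.Hoeffdings_lemma_nn_integral_0[OF l m0] by simp
  have step: "(\<integral>\<^sup>+y. ennreal (E (Suc k) (p(Suc k := y))) \<partial>G) \<le> ennreal (E k p)" for p
  proof (cases "x k p")
    case True
    have "E (Suc k) (p(Suc k := y)) = E k p * exp (- (l\<^sup>2 * (b - a)\<^sup>2 / 8)) * exp (l * (f y - m))" for y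
      using True dev_predictable[of k "Suc k" f m p y] plays_predictable[of k "Suc k" p y]
        x_predictable[of k "Suc k" p y]
      by (simp add: E_def dev_def plays_def exp_add[symmetric] algebra_simps)
    then have "(\<integral>\<^sup>+y. ennreal (E (Suc k) (p(Suc k := y))) \<partial>G)
        = ennreal (E k p * exp (- (l\<^sup>2 * (b - a)\<^sup>2 / 8))) * (\<integral>\<^sup>+y. ennreal (exp (l * (f y - m))) \<partial>G)"
      by (simp add: ennreal_mult E_def nn_integral_cmult)
    also have "\<dots> \<le> ennreal (E k p * exp (- (l\<^sup>2 * (b - a)\<^sup>2 / 8))) * ennreal (exp (l\<^sup>2 * (b - a)\<^sup>2 / 8))"
      by (intro mult_left_mono H) auto
    also have "\<dots> = ennreal (E k p * exp (- (l\<^sup>2 * (b - a)\<^sup>2 / 8)) * exp (l\<^sup>2 * (b - a)\<^sup>2 / 8))"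
      by (rule ennreal_mult[symmetric]) (auto simp: E_def)
    also have "\<dots> = ennreal (E k p)"
      by (simp add: mult.assoc exp_add[symmetric])
    finally show ?thesis .
  next
    case False
    have "E (Suc k) (p(Suc k := y)) = E k p" for y
      using False dev_predictable[of k "Suc k" f m p y] plays_predictable[of k "Suc k" p y]
        x_predictable[of k "Suc k" p y]
      by (simp add: E_def dev_def plays_def)
    then show ?thesis by (simp add: G.emeasure_space_1)
  qed
  have "(\<integral>\<^sup>+p. ennreal (E (Suc k) p) \<partial>M)
      = (\<integral>\<^sup>+p. (\<integral>\<^sup>+y. ennreal (E (Suc k) (p(Suc k := y))) \<partial>G) \<partial>M)"
    using Suc.prems by (intro nn_integral_resample) auto
  also have "\<dots> \<le> (\<integral>\<^sup>+p. ennreal (E k p) \<partial>M)"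
    by (intro nn_integral_mono step)
  also have "\<dots> \<le> 1" using Suc by (simp add: E_def)
  finally show ?case by (simp add: E_def)
qed

text \<open>The number of observations is random, so the bound is a union bound over its value,
  each value using its own optimal exponent in the supermartingale.\<close>

lemma prob_dev_gt:
  assumes k: "k \<le> T" and [measurable]: "f \<in> borel_measurable borel"
    and bnd: "AE y in G. f y \<in> {a..b}" and w: "w = b - a" "0 \<le> w"
    and eps: "\<And>n. 1 \<le> n \<Longrightarrow> n \<le> k \<Longrightarrow> 0 < eps (real n) \<and> exp (- (2 * real n * (eps (real n))\<^sup>2)) \<le> d"
  defines "m \<equiv> \<integral>y. f y \<partial>G"
  shows "M.prob {p \<in> space M. 0 < plays k p \<and> plays k p * eps (plays k p) * w < dev f m k p} \<le> k * d"
proof -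
  let ?B = "\<lambda>n. {p \<in> space M. plays k p = real n \<and> real n * eps (real n) * w < dev f m k p}"
  have [measurable]: "dev f m k \<in> borel_measurable M" "plays k \<in> borel_measurable M"
    "f \<in> borel_measurable G"
    using k by (auto intro!: dev_measurable plays_measurable borel_measurable_G assms(2))
  have sB[measurable]: "?B n \<in> sets M" for n by measurable
  have d0: "0 \<le> d" if "1 \<le> k" using eps[of 1] that by (smt (verit) exp_ge_zero le_refl)
  have each: "M.prob (?B n) \<le> d" if n: "n \<in> {1..k}" for n
  \<comment> \<open>For \<open>w = 0\<close> the exponent \<open>4 * e / w\<close> is meaningless;
    then \<open>f\<close> is almost surely equal to its mean and the deviation vanishes.\<close>
  proof (cases "w = 0")
    case True
    have "AE y in G. f y = a" using bnd by eventually_elim (use True w in auto)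
    moreover from this have "m = (\<integral>y. a \<partial>G)" unfolding m_def by (intro integral_cong_AE) auto
    ultimately have f: "AE y in G. f y = m" by (simp add: G.prob_space)
    have "AE p in M. \<forall>i\<in>{1..T}. f (p i) = m"
      by (intro AE_finite_allI AE_bid f) auto
    then have "AE p in M. p \<notin> ?B n"
    proof eventually_elim
      case (elim p)
      have "dev f m k p = 0" unfolding dev_def using elim k by (intro sum.neutral) auto
      then show ?case using True by auto
    qed
    then have "M.prob (?B n) = 0" using sB by (subst M.prob_eq_0) auto
    then show ?thesis using d0 n by auto
  next
    case False
    with w have w0: "0 < w" by simp
    define e where "e = eps (real n)"
    have e: "0 < e" "exp (- (2 * real n * e\<^sup>2)) \<le> d" using eps[of n] n by (auto simp: e_def)
    \<comment> \<open>Minimiser of \<open>l^2 * w^2 / 8 * n - l * n * e * w\<close> over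
      \<open>l\<close>; the minimum is \<open>- 2 * n * e^2\<close>.\<close>
    define l where "l = 4 * e / w"
    have l: "0 < l" using e w0 by (simp add: l_def)
    define E where "E p = exp (l * dev f m k p - l\<^sup>2 * (b - a)\<^sup>2 / 8 * plays k p)" for p
    have [measurable]: "E \<in> borel_measurable M"
      unfolding E_def by measurable
    \<comment> \<open>Exponential Markov inequality in pointwise form: on the event, the exponent of
      \<open>E\<close> is at least \<open>2 * n * e^2\<close>.\<close>
    have key: "indicator (?B n) p \<le> ennreal (exp (- (2 * real n * e\<^sup>2))) * ennreal (E p)" for p
    proof (cases "p \<in> ?B n")
      case True
      then have "real n * e * w \<le> dev f m k p" and pn: "plays k p = real n" by (auto simp: e_def)
      then have "l * (real n * e * w) \<le> l * dev f m k p" using l by (intro mult_left_mono) auto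
      moreover have "l * (real n * e * w) = 4 * real n * e\<^sup>2"
        using w0 by (simp add: l_def power2_eq_square)
      moreover have "l\<^sup>2 * (b - a)\<^sup>2 / 8 = 2 * e\<^sup>2"
        using w0 w by (simp add: l_def power_divide power_mult_distrib)
      ultimately have "2 * real n * e\<^sup>2 \<le> l * dev f m k p - l\<^sup>2 * (b - a)\<^sup>2 / 8 * plays k p"
        unfolding pn by (simp only: mult.assoc mult.commute[of "e\<^sup>2"])
      then have "1 \<le> exp (- (2 * real n * e\<^sup>2)) * E p"
        unfolding E_def by (simp add: exp_add[symmetric])
      then have "1 \<le> ennreal (exp (- (2 * real n * e\<^sup>2)) * E p)" by simp
      then show ?thesis using True by (simp add: ennreal_mult E_def)
    qed simp
    have "emeasure M (?B n) = (\<integral>\<^sup>+p. indicator (?B n) p \<partial>M)" by simp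
    also have "\<dots> \<le> (\<integral>\<^sup>+p. ennreal (exp (- (2 * real n * e\<^sup>2))) * ennreal (E p) \<partial>M)"
      by (intro nn_integral_mono key)
    also have "\<dots> = ennreal (exp (- (2 * real n * e\<^sup>2))) * (\<integral>\<^sup>+p. ennreal (E p) \<partial>M)"
      by (intro nn_integral_cmult) measurable
    also have "\<dots> \<le> ennreal (exp (- (2 * real n * e\<^sup>2))) * 1"
      unfolding E_def m_def using dev_exp_moment[OF k _ bnd l] by (intro mult_left_mono) auto
    finally have "M.prob (?B n) \<le> exp (- (2 * real n * e\<^sup>2))"
      by (simp add: M.emeasure_eq_measure)
    then show ?thesis using e by simp
  qed
  have "{p \<in> space M. 0 < plays k p \<and> plays k p * eps (plays k p) * w < dev f m k p} \<subseteq> (\<Union>n\<in>{1..k}. ?B n)"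
  proof
    fix p assume p: "p \<in> {p \<in> space M. 0 < plays k p \<and> plays k p * eps (plays k p) * w < dev f m k p}"
    obtain n where "n \<le> k" "plays k p = real n" using plays_nat by blast
    with p show "p \<in> (\<Union>n\<in>{1..k}. ?B n)" by (auto intro!: bexI[of _ n])
  qed
  then have "M.prob {p \<in> space M. 0 < plays k p \<and> plays k p * eps (plays k p) * w < dev f m k p}
      \<le> M.prob (\<Union>n\<in>{1..k}. ?B n)"
    by (intro M.finite_measure_mono) auto
  also have "\<dots> \<le> (\<Sum>n\<in>{1..k}. M.prob (?B n))"
    by (intro M.finite_measure_subadditive_finite) auto
  also have "\<dots> \<le> (\<Sum>n\<in>{1..k}. d)" by (intro sum_mono each)
  finally show ?thesis by simp
qed

text \<open>Expanding the square, the cross term has mean 0 because the past sum is predictable, and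
  each new square is at most \<open>w^2\<close>. The function varies with \<open>j\<close> since the
  value, and hence the cost function, changes from round to round.\<close>

lemma second_moment_le:
  fixes f :: "nat \<Rightarrow> real \<Rightarrow> real" and w :: real
  assumes "k \<le> T" and [measurable]: "\<And>j. f j \<in> borel_measurable borel"
    and bnd: "\<And>j. j < T \<Longrightarrow> AE y in G. \<bar>f j y\<bar> \<le> w"
    and mean: "\<And>j. j < T \<Longrightarrow> (\<integral>y. f j y \<partial>G) = 0"
  defines "S \<equiv> \<lambda>k p. \<Sum>j<k. of_bool (x j p) * f j (p (Suc j))"
  shows "integrable M (\<lambda>p. (S k p)\<^sup>2) \<and> (\<integral>p. (S k p)\<^sup>2 \<partial>M) \<le> real k * w\<^sup>2"
  using assms(1)
proof (induction k)
  case 0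
  then show ?case by (simp add: S_def)
next
  case (Suc k)
  then have k: "k < T" by simp
  have w0: "0 \<le> w"
  proof -
    have "AE y in G. 0 \<le> w" using bnd[OF k] by eventually_elim auto
    then show ?thesis by simp
  qed
  have fx[measurable]: "(\<lambda>p. of_bool (x j p) * f j (p (Suc j))) \<in> borel_measurable M" if "j < T" for j
  proof -
    have [measurable]: "(\<lambda>p. p (Suc j)) \<in> borel_measurable M" "Measurable.pred M (x j)"
      using that by auto
    show ?thesis by measurable
  qed
  have Sm[measurable]: "S j \<in> borel_measurable M" if "j \<le> T" for j
    unfolding S_def using that by (intro borel_measurable_sum fx) auto
  have AEb: "AE p in M. \<forall>j\<in>{..<T}. \<bar>f j (p (Suc j))\<bar> \<le> w"
    using bnd by (intro AE_finite_allI) (auto intro!: AE_bid)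
  have AES: "AE p in M. \<bar>S k p\<bar> \<le> real k * w"
    using AEb
  proof eventually_elim
    case (elim p)
    have "\<bar>S k p\<bar> \<le> (\<Sum>j<k. \<bar>of_bool (x j p) * f j (p (Suc j))\<bar>)" unfolding S_def by (rule sum_abs)
    also have "\<dots> \<le> (\<Sum>j<k. w)" using elim k w0 by (intro sum_mono) (auto simp: of_bool_def)
    finally show ?case by simp
  qed
  \<comment> \<open>Past sum times current decision: everything in the cross term that does not see
    bid \<open>Suc k\<close>.\<close>
  define A where "A p = S k p * of_bool (x k p)" for p
  have [measurable]: "S k \<in> borel_measurable M" "Measurable.pred M (x k)"
    "(\<lambda>p. p (Suc k)) \<in> borel_measurable M"
    using k by (auto intro!: Sm)
  have [measurable]: "A \<in> borel_measurable M" unfolding A_def by measurable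
  have iA: "integrable M A"
    by (rule M.integrable_const_bound[of _ "real k * w"])
       (use AES w0 in \<open>auto simp: A_def of_bool_def elim!: eventually_mono\<close>)
  have iAf: "integrable M (\<lambda>p. A p * f k (p (Suc k)))"
  proof (rule M.integrable_const_bound[of _ "real k * w * w"])
    show "AE p in M. norm (A p * f k (p (Suc k))) \<le> real k * w * w"
      using AES AEb
    proof eventually_elim
      case (elim p)
      have "\<bar>A p\<bar> \<le> real k * w" using elim(1) w0 by (auto simp: A_def of_bool_def)
      moreover have "\<bar>f k (p (Suc k))\<bar> \<le> w" using elim k by auto
      ultimately show ?case by (auto simp: abs_mult intro!: mult_mono w0)
    qed
  qed measurable
  have inv: "A (p(Suc k := y)) = A p" for p y
    unfolding A_def S_def by (auto simp: x_predictable intro!: sum.cong)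
  have cross: "(\<integral>p. A p * f k (p (Suc k)) \<partial>M) = 0"
    using integral_predictable_mult[OF _ inv iA iAf] mean k by simp
  define Q where "Q p = (of_bool (x k p) * f k (p (Suc k)))\<^sup>2" for p
  have [measurable]: "Q \<in> borel_measurable M" unfolding Q_def using fx[OF k] by measurable
  have Qb: "AE p in M. Q p \<le> w\<^sup>2"
    using AEb
  proof eventually_elim
    case (elim p)
    then have "\<bar>f k (p (Suc k))\<bar> \<le> w" using k by auto
    then show ?case using w0 by (auto simp: Q_def of_bool_def abs_le_square_iff[symmetric])
  qed
  have iQ: "integrable M Q"
    by (rule M.integrable_const_bound[of _ "w\<^sup>2"]) (use Qb in \<open>auto simp: Q_def\<close>)
  have Qle: "(\<integral>p. Q p \<partial>M) \<le> w\<^sup>2"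
    using integral_mono_AE[OF iQ _ Qb] by (simp add: M.prob_space)
  have IH: "integrable M (\<lambda>p. (S k p)\<^sup>2)" "(\<integral>p. (S k p)\<^sup>2 \<partial>M) \<le> real k * w\<^sup>2"
    using Suc by auto
  have eq: "(S (Suc k) p)\<^sup>2 = (S k p)\<^sup>2 + 2 * (A p * f k (p (Suc k))) + Q p" for p
    unfolding S_def A_def Q_def by (simp add: power2_eq_square algebra_simps del: sum_mult_of_bool_eq sum_of_bool_mult_eq)
  show ?case
    unfolding eq using IH iAf iQ cross Qle by (simp add: distrib_right)
qed

lemma expectation_abs_le:
  fixes f :: "nat \<Rightarrow> real \<Rightarrow> real" and w :: real
  assumes "\<And>j. f j \<in> borel_measurable borel"
    and bnd: "\<And>j. j < T \<Longrightarrow> AE y in G. \<bar>f j y\<bar> \<le> w" and w: "0 < w"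
    and mean: "\<And>j. j < T \<Longrightarrow> (\<integral>y. f j y \<partial>G) = 0"
  defines "S \<equiv> \<lambda>p. \<Sum>j<T. of_bool (x j p) * f j (p (Suc j))"
  shows "integrable M S" "(\<integral>p. \<bar>S p\<bar> \<partial>M) \<le> w * sqrt (real T)"
proof -
  note [measurable] = assms(1)
  have fx[measurable]: "(\<lambda>p. of_bool (x j p) * f j (p (Suc j))) \<in> borel_measurable M" if "j < T" for j
  proof -
    have [measurable]: "(\<lambda>p. p (Suc j)) \<in> borel_measurable M" "Measurable.pred M (x j)"
      using that by auto
    show ?thesis by measurable
  qed
  have Sm[measurable]: "S \<in> borel_measurable M"
    unfolding S_def by (intro borel_measurable_sum fx) auto
  have S2: "integrable M (\<lambda>p. (S p)\<^sup>2)" "(\<integral>p. (S p)\<^sup>2 \<partial>M) \<le> real T * w\<^sup>2"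
    using second_moment_le[OF order.refl assms(1,2,4)] by (auto simp: S_def)
  show "integrable M S"
    by (rule M.square_integrable_imp_integrable) (use S2 in auto)
  then have iabs: "integrable M (\<lambda>p. \<bar>S p\<bar>)" by simp
  \<comment> \<open>The variance of \<open>\<bar>S\<bar>\<close> is nonnegative, which turns the
    second moment into a bound on the first.\<close>
  have "(\<integral>p. \<bar>S p\<bar> \<partial>M)\<^sup>2 \<le> (\<integral>p. \<bar>S p\<bar>\<^sup>2 \<partial>M)"
    using M.variance_positive[of "\<lambda>p. \<bar>S p\<bar>"] M.variance_eq[of "\<lambda>p. \<bar>S p\<bar>"] iabs S2 by simp
  also have "\<dots> \<le> (w * sqrt (real T))\<^sup>2"
    using S2 by (simp add: power_mult_distrib mult.commute)
  finally show "(\<integral>p. \<bar>S p\<bar> \<partial>M) \<le> w * sqrt (real T)"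
    by (rule power2_le_imp_le) (use w in auto)
qed

end

section \<open>The algorithm as a predictable play\<close>

lemma reward_bounds: "0 \<le> v \<Longrightarrow> 0 \<le> y \<Longrightarrow> 0 \<le> reward v y \<and> reward v y \<le> v"
  by (auto simp: reward_def)

lemma cost_bounds: "0 \<le> v \<Longrightarrow> 0 \<le> y \<Longrightarrow> 0 \<le> cost v y \<and> cost v y \<le> v"
  by (auto simp: cost_def)

lemma reward_measurable [measurable]: "reward v \<in> borel_measurable borel"
  unfolding reward_def[abs_def] by measurable

lemma cost_measurable [measurable]: "cost v \<in> borel_measurable borel"
  unfolding cost_def[abs_def] by measurable

text \<open>Relaxation that drops the budget constraint. The factor \<open>\<rho> / vbar\<close> in
  front of the benchmark makes it affordable: the comparator plays each round with just that
  probability.\<close>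

lemma hindsight_le_sum_reward:
  assumes "0 \<le> \<rho>"
  shows "hindsight \<rho> T v p \<le> (\<Sum>t\<in>{1..T}. reward (v t) (p t))"
proof -
  define F where "F = {S. S \<subseteq> {1..T} \<and> (\<Sum>t\<in>S. cost (v t) (p t)) \<le> real T * \<rho>}"
  have "finite F" unfolding F_def by (rule finite_subset[of _ "Pow {1..T}"]) blast+
  moreover have "{} \<in> F" using assms by (simp add: F_def)
  moreover have "(\<Sum>t\<in>S. reward (v t) (p t)) \<le> (\<Sum>t\<in>{1..T}. reward (v t) (p t))" if "S \<in> F" for S
    using that by (intro sum_mono2) (auto simp: F_def reward_def)
  ultimately show ?thesis
    unfolding hindsight_def F_def[symmetric] by (intro Max.boundedI) blast+
qed

locale ogd_cb = iid_bids G T for G :: "real measure" and T :: nat +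
  fixes vbar \<rho> :: real and v :: "nat \<Rightarrow> real"
  assumes vbar_pos: "0 < vbar" and rho_pos: "0 < \<rho>" and rho_le: "\<rho> \<le> vbar"
    and T_pos: "0 < T"
    and v_range: "t \<in> {1..T} \<Longrightarrow> v t \<in> {0..vbar}"
    and bid_range: "AE y in G. y \<in> {0..vbar}"
begin

section \<open>States of the run, their predictability and measurability\<close>

definition st :: "nat \<Rightarrow> (nat \<Rightarrow> real) \<Rightarrow> ogd_state" where
  "st k p = ogd_run vbar \<rho> T v p k"

abbreviation V :: "nat \<Rightarrow> real" where "V k \<equiv> v (Suc k)"

definition eps :: "real \<Rightarrow> real" where
  "eps n = sqrt ((ln 2 + 2 * ln (real T)) / (2 * n))"

text \<open>Confidence width for a single observation; \<open>n\<close> observations divide it by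
  \<open>sqrt n\<close>.\<close>

definition E0 :: real where
  "E0 = sqrt ((ln 2 + 2 * ln (real T)) / 2)"

definition est_reward :: "nat \<Rightarrow> (nat \<Rightarrow> real) \<Rightarrow> real" where
  "est_reward k p = (\<Sum>\<tau>\<in>obs (st k p). reward (V k) (p \<tau>)) / real (card (obs (st k p)))
     + eps (real (card (obs (st k p)))) * V k"

definition est_cost :: "nat \<Rightarrow> (nat \<Rightarrow> real) \<Rightarrow> real" where
  "est_cost k p = (\<Sum>\<tau>\<in>obs (st k p). cost (V k) (p \<tau>)) / real (card (obs (st k p)))
     - 2 * eps (real (card (obs (st k p)))) * V k"

definition alive :: "nat \<Rightarrow> (nat \<Rightarrow> real) \<Rightarrow> bool" where
  "alive k p \<longleftrightarrow> \<not> stopped (st k p)"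

text \<open>Being alive is built in, so sums over played rounds need no separate stopping time. The
  case \<open>k = 0\<close> is the forced first play, made before any observation exists.\<close>

definition play :: "nat \<Rightarrow> (nat \<Rightarrow> real) \<Rightarrow> bool" where
  "play k p \<longleftrightarrow> alive k p \<and> (k = 0 \<or> lam (st k p) * est_cost k p \<le> est_reward k p)"

text \<open>Increment direction of the multiplier. After stopping it equals \<open>- \<rho>\<close>
  although the multiplier is frozen, hence the factor \<open>alive\<close> in later sums.\<close>

definition grad :: "nat \<Rightarrow> (nat \<Rightarrow> real) \<Rightarrow> real" where
  "grad k p = of_bool (play k p) * est_cost k p - \<rho>"

lemma st_0: "st 0 p = \<lparr>obs = {}, budget = \<rho> * real T, lam = 0, rev = 0, stopped = False\<rparr>"
  by (simp add: st_def)

lemma alive_0: "alive 0 p" by (simp add: alive_def st_0)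

lemma play_0: "play 0 p" by (simp add: play_def alive_0)

lemma play_alive: "play k p \<Longrightarrow> alive k p" by (simp add: play_def)

lemma st_Suc:
  "st (Suc k) p = (if alive k p then
     \<lparr>obs = (if play k p then obs (st k p) \<union> {Suc k} else obs (st k p)),
      budget = budget (st k p) - of_bool (play k p) * cost (V k) (p (Suc k)),
      lam = (if k = 0 then lam (st k p)
             else max 0 (lam (st k p) + 1 / (vbar * sqrt (real (Suc k))) * grad k p)),
      rev = rev (st k p) + of_bool (play k p) * reward (V k) (p (Suc k)),
      stopped = budget (st k p) - of_bool (play k p) * cost (V k) (p (Suc k)) < vbar\<rparr>
   else st k p)"
  by (simp add: st_def ogd_step_def alive_def[unfolded st_def] play_def[unfolded st_def]
      est_cost_def[unfolded st_def] est_reward_def[unfolded st_def] grad_def[unfolded st_def]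
      eps_def Let_def)

lemma obs_eq: "obs (st k p) = Suc ` {j. j < k \<and> play j p}"
proof (induction k)
  case 0
  then show ?case by (simp add: st_0)
next
  case (Suc k)
  have "{j. j < Suc k \<and> play j p} = (if play k p then insert k {j. j < k \<and> play j p} else {j. j < k \<and> play j p})"
    by (auto simp: less_Suc_eq)
  then show ?case using Suc play_alive[of k p] by (auto simp: st_Suc)
qed

lemma sum_obs: "(\<Sum>\<tau>\<in>obs (st k p). f \<tau>) = (\<Sum>j<k. of_bool (play j p) * (f (Suc j) :: real))"
  unfolding obs_eq by (subst sum.reindex) (auto intro!: sum.cong)

lemma card_obs: "real (card (obs (st k p))) = (\<Sum>j<k. of_bool (play j p))"
  using sum_obs[of "\<lambda>_. 1" k p] by simp

text \<open>The estimates read only bids with index in \<open>obs\<close>, all at most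
  \<open>k\<close>. Invariance of the state is assumed so that the lemma can serve inside the
  induction for \<open>st_predictable\<close>.\<close>

lemma est_predictable:
  assumes "k < i" and IH: "st k (p(i := y)) = st k p"
  shows "est_reward k (p(i := y)) = est_reward k p" "est_cost k (p(i := y)) = est_cost k p"
    "play k (p(i := y)) = play k p"
proof -
  have "\<tau> \<noteq> i" if "\<tau> \<in> obs (st k p)" for \<tau>
    using that assms(1) by (auto simp: obs_eq)
  then have s: "(\<Sum>\<tau>\<in>obs (st k p). f ((p(i := y)) \<tau>)) = (\<Sum>\<tau>\<in>obs (st k p). f (p \<tau>))"
    for f :: "real \<Rightarrow> real"
    by (intro sum.cong) auto
  show e: "est_reward k (p(i := y)) = est_reward k p" "est_cost k (p(i := y)) = est_cost k p"
    unfolding est_reward_def est_cost_def IH s by (rule refl)+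
  show "play k (p(i := y)) = play k p"
    unfolding play_def alive_def IH e by (rule refl)
qed

lemma st_predictable: "k < i \<Longrightarrow> st k (p(i := y)) = st k p"
proof (induction k)
  case 0
  then show ?case by (simp add: st_0)
next
  case (Suc k)
  then have k: "k < i" and IH: "st k (p(i := y)) = st k p" using Suc_lessD by blast+
  have "(p(i := y)) (Suc k) = p (Suc k)" using Suc.prems by auto
  then show ?case
    unfolding st_Suc grad_def alive_def est_predictable[OF k IH] IH by (simp only:)
qed

lemma play_predictable: "k < i \<Longrightarrow> play k (p(i := y)) = play k p"
  by (intro est_predictable st_predictable)

text \<open>The components feed into each other, so one induction carries them together. Sums over
  the random set \<open>obs\<close> become sums over a fixed range weighted by the indicators of
  earlier plays.\<close>

lemma st_measurable:
  "k \<le> T \<Longrightarrow> (\<lambda>p. lam (st k p)) \<in> borel_measurable M \<and> (\<lambda>p. budget (st k p)) \<in> borel_measurable M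
     \<and> Measurable.pred M (alive k) \<and> (\<forall>j<k. Measurable.pred M (play j))"
proof (induction k)
  case 0
  then show ?case by (simp add: st_0 alive_0)
next
  case (Suc k)
  then have [measurable]: "(\<lambda>p. lam (st k p)) \<in> borel_measurable M"
    "(\<lambda>p. budget (st k p)) \<in> borel_measurable M" "Measurable.pred M (alive k)"
    and pl: "\<And>j. j < k \<Longrightarrow> Measurable.pred M (play j)" by auto
  have pm: "(\<lambda>p. p (Suc j)) \<in> borel_measurable M" if "j \<le> k" for j using that Suc.prems by auto
  note [measurable] = pm[OF order.refl]
  have s: "(\<lambda>p. \<Sum>j<k. of_bool (play j p) * f (p (Suc j)) :: real) \<in> borel_measurable M"
    if [measurable]: "f \<in> borel_measurable borel" for f
  proof (rule borel_measurable_sum)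
    fix j assume "j \<in> {..<k}"
    then have [measurable]: "(\<lambda>p. p (Suc j)) \<in> borel_measurable M" "Measurable.pred M (play j)"
      using pm pl by auto
    show "(\<lambda>p. of_bool (play j p) * f (p (Suc j))) \<in> borel_measurable M" by measurable
  qed
  note [measurable] = s[OF reward_measurable[of "V k"]] s[OF cost_measurable[of "V k"]]
  have [measurable]: "(\<lambda>p. real (card (obs (st k p)))) \<in> borel_measurable M"
    using s[of "\<lambda>_. 1"] by (simp add: card_obs)
  have [measurable]: "(\<lambda>p. est_reward k p) \<in> borel_measurable M" "(\<lambda>p. est_cost k p) \<in> borel_measurable M"
    unfolding est_reward_def est_cost_def sum_obs eps_def by measurable
  have "Measurable.pred M (\<lambda>p. lam (st k p) * est_cost k p \<le> est_reward k p)"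
    unfolding pred_def by (rule borel_measurable_le) measurable
  then have [measurable]: "Measurable.pred M (play k)"
    unfolding play_def[abs_def] by (intro pred_intros_logic) auto
  have [measurable]: "(\<lambda>p. grad k p) \<in> borel_measurable M"
    unfolding grad_def by measurable
  have lam: "lam (st (Suc k) p) = (if alive k p \<and> k \<noteq> 0
      then max 0 (lam (st k p) + 1 / (vbar * sqrt (real (Suc k))) * grad k p) else lam (st k p))"
    and bud: "budget (st (Suc k) p) = (if alive k p
      then budget (st k p) - of_bool (play k p) * cost (V k) (p (Suc k)) else budget (st k p))"
    and ali: "alive (Suc k) p \<longleftrightarrow> alive k p \<and>
      \<not> (budget (st k p) - of_bool (play k p) * cost (V k) (p (Suc k)) < vbar)" for p
    by (simp_all add: st_Suc alive_def)
  show ?case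
    unfolding lam bud ali[abs_def] using pl by (auto simp: less_Suc_eq)
qed

sublocale predictable_play G T play
proof
  show "Measurable.pred M (play k)" if "k < T" for k
    using st_measurable[of T] that by auto
  show "play k (p(i := y)) = play k p" if "k < i" for k i p y
    using that by (rule play_predictable)
qed

lemma card_obs_plays: "real (card (obs (st k p))) = plays k p"
  by (simp add: card_obs plays_def)

section \<open>Sample averages, confidence widths and bad events\<close>

definition avg :: "(real \<Rightarrow> real) \<Rightarrow> nat \<Rightarrow> (nat \<Rightarrow> real) \<Rightarrow> real" where
  "avg f k p = (\<Sum>j<k. of_bool (play j p) * f (p (Suc j))) / plays k p"

lemma est_reward_eq: "est_reward k p = avg (reward (V k)) k p + eps (plays k p) * V k"
  by (simp only: est_reward_def sum_obs card_obs_plays avg_def)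

lemma est_cost_eq: "est_cost k p = avg (cost (V k)) k p - 2 * eps (plays k p) * V k"
  by (simp only: est_cost_def sum_obs card_obs_plays avg_def)

lemma log_pos: "0 < ln 2 + 2 * ln (real T)"
  using T_pos by (intro add_pos_nonneg) auto

lemma E0_nonneg: "0 \<le> E0" using log_pos by (simp add: E0_def)

lemma eps_eq: "eps n = E0 / sqrt n"
  by (simp add: eps_def E0_def real_sqrt_divide real_sqrt_mult)

lemma eps_plays: "0 \<le> eps (plays k p)" "eps (plays k p) \<le> E0"
proof -
  show "0 \<le> eps (plays k p)" using E0_nonneg plays_nonneg by (simp add: eps_eq)
  obtain n where n: "plays k p = real n" using plays_nat by blast
  show "eps (plays k p) \<le> E0"
  \<comment> \<open>With no observation, division by zero makes the width 0, which also satisfies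
    the bound.\<close>
  proof (cases "n = 0")
    case False
    then have "1 \<le> sqrt (real n)" by simp
    then have "E0 / sqrt (real n) \<le> E0 / 1" using E0_nonneg by (intro divide_left_mono) auto
    then show ?thesis by (simp add: eps_eq n)
  qed (use n E0_nonneg in \<open>simp add: eps_eq\<close>)
qed

lemma V_range: "k < T \<Longrightarrow> 0 \<le> V k" "k < T \<Longrightarrow> V k \<le> vbar"
  using v_range[of "Suc k"] by auto

definition mean_reward :: "nat \<Rightarrow> real" where "mean_reward k = (\<integral>y. reward (V k) y \<partial>G)"
definition mean_cost :: "nat \<Rightarrow> real" where "mean_cost k = (\<integral>y. cost (V k) y \<partial>G)"

lemma AE_reward: "k < T \<Longrightarrow> AE y in G. 0 \<le> reward (V k) y \<and> reward (V k) y \<le> V k"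
  using bid_range reward_bounds V_range(1) by (auto elim!: eventually_mono)

lemma AE_cost: "k < T \<Longrightarrow> AE y in G. 0 \<le> cost (V k) y \<and> cost (V k) y \<le> V k"
  using bid_range cost_bounds V_range(1) by (auto elim!: eventually_mono)

lemma integrable_reward:
  assumes "k < T" shows "integrable G (reward (V k))"
proof (rule G.integrable_const_bound[of _ "V k"])
  show "AE y in G. norm (reward (V k) y) \<le> V k"
    using AE_reward[OF assms] by eventually_elim auto
qed (rule borel_measurable_G, measurable)

lemma integrable_cost:
  assumes "k < T" shows "integrable G (cost (V k))"
proof (rule G.integrable_const_bound[of _ "V k"])
  show "AE y in G. norm (cost (V k) y) \<le> V k"
    using AE_cost[OF assms] by eventually_elim auto
qed (rule borel_measurable_G, measurable)

lemma mean_reward_range: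
  assumes "k < T" shows "0 \<le> mean_reward k" "mean_reward k \<le> V k"
  using AE_reward[OF assms] G.integral_ge_const[OF integrable_reward[OF assms], of 0]
    G.integral_le_const[OF integrable_reward[OF assms], of "V k"]
  by (auto simp: mean_reward_def)

lemma mean_cost_range:
  assumes "k < T" shows "0 \<le> mean_cost k" "mean_cost k \<le> V k"
  using AE_cost[OF assms] G.integral_ge_const[OF integrable_cost[OF assms], of 0]
    G.integral_le_const[OF integrable_cost[OF assms], of "V k"]
  by (auto simp: mean_cost_def)

text \<open>One-sided failure of the confidence bound, multiplied through by the number of
  observations. Deviations below the mean are covered by inserting \<open>- f\<close>.\<close>

definition bad :: "(real \<Rightarrow> real) \<Rightarrow> nat \<Rightarrow> (nat \<Rightarrow> real) \<Rightarrow> bool" where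
  "bad f k p \<longleftrightarrow> 0 < plays k p \<and> plays k p * eps (plays k p) * V k < dev f (\<integral>y. f y \<partial>G) k p"

lemma bad_measurable [measurable]:
  assumes "k \<le> T" and [measurable]: "f \<in> borel_measurable borel"
  shows "Measurable.pred M (bad f k)"
proof -
  have [measurable]: "plays k \<in> borel_measurable M" "dev f (\<integral>y. f y \<partial>G) k \<in> borel_measurable M"
    using assms by (auto intro!: plays_measurable dev_measurable)
  show ?thesis unfolding bad_def[abs_def] eps_def by measurable
qed

text \<open>The width makes each possible observation count fail with probability at most
  \<open>1 / (2 * T^2)\<close>; there are at most \<open>T\<close> counts. Summed over all rounds,
  the expected number of failures stays bounded.\<close>

lemma expectation_bad:
  assumes k: "k < T" and f: "f \<in> borel_measurable borel"
    and bnd: "AE y in G. f y \<in> {a..b}" "b - a = V k"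
  shows "(\<integral>p. of_bool (bad f k p) \<partial>M) \<le> 1 / (2 * real T)"
proof -
  have e: "0 < eps (real n) \<and> exp (- (2 * real n * (eps (real n))\<^sup>2)) \<le> 1 / (2 * (real T)\<^sup>2)" if "1 \<le> n" for n
  proof -
    have "2 * real n * (eps (real n))\<^sup>2 = ln 2 + 2 * ln (real T)"
      using that log_pos by (simp add: eps_def)
    moreover have "exp (- (ln 2 + 2 * ln (real T))) = 1 / (2 * (real T)\<^sup>2)"
      using T_pos by (simp only: exp_minus exp_add exp_double) (simp add: divide_simps)
    ultimately show ?thesis using that log_pos by (simp add: eps_def)
  qed
  have [measurable]: "Measurable.pred M (bad f k)" using k f by (intro bad_measurable) auto
  have "(\<integral>p. of_bool (bad f k p) \<partial>M) = (\<integral>p. indicator {p\<in>space M. bad f k p} p \<partial>M)"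
    by (intro Bochner_Integration.integral_cong) auto
  also have "\<dots> = M.prob {p\<in>space M. bad f k p}" by simp
  also have "\<dots> \<le> real k * (1 / (2 * (real T)\<^sup>2))"
    unfolding bad_def by (rule prob_dev_gt[OF _ f bnd(1)]) (use k bnd V_range(1)[OF k] e in auto)
  also have "\<dots> \<le> real T * (1 / (2 * (real T)\<^sup>2))"
    using k by (intro mult_right_mono) auto
  also have "\<dots> = 1 / (2 * real T)" using T_pos by (simp add: power2_eq_square)
  finally show ?thesis .
qed

end

section \<open>Pathwise analysis\<close>

lemma sum_of_bool_mult_le:
  fixes f :: "'a \<Rightarrow> real"
  assumes "\<And>j. j \<in> A \<Longrightarrow> f j \<le> b"
  shows "(\<Sum>j\<in>A. of_bool (P j) * f j) \<le> b * (\<Sum>j\<in>A. of_bool (P j))"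
  unfolding sum_distrib_left using assms by (intro sum_mono) auto

context ogd_cb
begin

text \<open>The almost sure set on which the pathwise inequalities are proved.\<close>

definition box :: "(nat \<Rightarrow> real) \<Rightarrow> bool" where
  "box p \<longleftrightarrow> (\<forall>j<T. p (Suc j) \<in> {0..vbar})"

lemma AE_box: "AE p in M. box p"
proof -
  have "AE p in M. \<forall>j\<in>{..<T}. p (Suc j) \<in> {0..vbar}"
    by (intro AE_finite_allI AE_bid bid_range) auto
  then show ?thesis by eventually_elim (auto simp: box_def)
qed

lemma avg_range:
  assumes "\<And>j. j < k \<Longrightarrow> 0 \<le> f (p (Suc j)) \<and> f (p (Suc j)) \<le> w" "0 \<le> w"
  shows "0 \<le> avg f k p" "avg f k p \<le> w"
proof -
  show "0 \<le> avg f k p"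
    unfolding avg_def using assms by (intro divide_nonneg_nonneg sum_nonneg plays_nonneg) auto
  have "(\<Sum>j<k. of_bool (play j p) * f (p (Suc j))) \<le> w * plays k p"
    unfolding plays_def using assms by (intro sum_of_bool_mult_le) auto
  then show "avg f k p \<le> w"
    using assms plays_nonneg[of k p] by (cases "plays k p = 0") (auto simp: avg_def divide_simps)
qed

lemma avg_reward_range:
  assumes "k < T" "box p" shows "0 \<le> avg (reward (V k)) k p" "avg (reward (V k)) k p \<le> V k"
  using assms V_range(1)[of k] reward_bounds by (auto simp: box_def intro!: avg_range)

lemma avg_cost_range:
  assumes "k < T" "box p" shows "0 \<le> avg (cost (V k)) k p" "avg (cost (V k)) k p \<le> V k"
  using assms V_range(1)[of k] cost_bounds by (auto simp: box_def intro!: avg_range)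

lemma eps_V:
  assumes "k < T" shows "0 \<le> eps (plays k p) * V k" "eps (plays k p) * V k \<le> eps (plays k p) * vbar"
    "eps (plays k p) * V k \<le> E0 * vbar"
  using assms V_range[of k] eps_plays[of k p] E0_nonneg by (auto intro!: mult_mono)

lemma est_cost_le: "k < T \<Longrightarrow> box p \<Longrightarrow> est_cost k p \<le> vbar"
  using avg_cost_range[of k p] eps_V[of k p] V_range[of k] by (simp add: est_cost_eq)

lemma est_cost_ge: "k < T \<Longrightarrow> box p \<Longrightarrow> - 2 * E0 * vbar \<le> est_cost k p"
  using avg_cost_range[of k p] eps_V[of k p] V_range[of k] by (simp add: est_cost_eq)

lemma est_reward_le: "k < T \<Longrightarrow> box p \<Longrightarrow> est_reward k p \<le> vbar * (1 + E0)"
  using avg_reward_range[of k p] eps_V[of k p] V_range[of k] by (simp add: est_reward_eq algebra_simps)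

lemma est_reward_nonneg: "k < T \<Longrightarrow> box p \<Longrightarrow> 0 \<le> est_reward k p"
  using avg_reward_range[of k p] eps_V[of k p] by (simp add: est_reward_eq)

section \<open>Size of the multiplier and regret of gradient descent\<close>

lemma lam_Suc: "lam (st (Suc k) p) = (if alive k p \<and> k \<noteq> 0
    then max 0 (lam (st k p) + 1 / (vbar * sqrt (real (Suc k))) * grad k p) else lam (st k p))"
  by (simp add: st_Suc)

definition lam_max :: real where "lam_max = vbar * (1 + E0) / \<rho> + 1"

lemma lam_max_ge_1: "1 \<le> lam_max"
  using E0_nonneg vbar_pos rho_pos by (simp add: lam_max_def)

text \<open>Playing forces \<open>\<lambda>\<close> times the estimated cost below the estimated reward, so \<open>\<lambda>\<close> can only
  grow, by at most 1, while it is below (estimated reward) / \<open>\<rho>\<close>.\<close>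

lemma lam_range:
  assumes "box p" shows "k \<le> T \<Longrightarrow> 0 \<le> lam (st k p) \<and> lam (st k p) \<le> lam_max"
proof (induction k)
  case 0
  then show ?case using lam_max_ge_1 by (simp add: st_0)
next
  case (Suc k)
  then have k: "k < T" and IH: "0 \<le> lam (st k p)" "lam (st k p) \<le> lam_max" by auto
  define \<eta> where "\<eta> = 1 / (vbar * sqrt (real (Suc k)))"
  have \<eta>: "0 < \<eta>" "\<eta> * vbar \<le> 1" using vbar_pos by (auto simp: \<eta>_def divide_simps)
  show ?case
  proof (cases "alive k p \<and> k \<noteq> 0")
    case True
    have "lam (st k p) + \<eta> * grad k p \<le> lam_max"
    proof (cases "grad k p \<le> 0")
      case True
      then show ?thesis using \<eta> IH mult_nonneg_nonpos[of \<eta> "grad k p"] by auto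
    next
      case False
      then have c: "play k p" "\<rho> < est_cost k p" using rho_pos by (auto simp: grad_def of_bool_def split: if_splits)
      then have "lam (st k p) * est_cost k p \<le> est_reward k p" using True by (simp add: play_def)
      moreover have "lam (st k p) * \<rho> \<le> lam (st k p) * est_cost k p" using c IH by (intro mult_left_mono) auto
      ultimately have "lam (st k p) * \<rho> \<le> vbar * (1 + E0)" using est_reward_le[OF k assms] by linarith
      then have "lam (st k p) \<le> vbar * (1 + E0) / \<rho>" using rho_pos by (simp add: pos_le_divide_eq)
      moreover have "\<eta> * grad k p \<le> \<eta> * vbar"
        using \<eta> c est_cost_le[OF k assms] rho_pos by (intro mult_left_mono) (auto simp: grad_def)
      ultimately show ?thesis using \<eta> unfolding lam_max_def by linarith
    qed
    then show ?thesis using True lam_max_ge_1 by (simp add: lam_Suc \<eta>_def)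
  next
    case False
    then show ?thesis using IH by (auto simp: lam_Suc)
  qed
qed

text \<open>The first term bounds the growth of the potential through its increasing weight, the
  second the squared gradients. Both are of order \<open>E0^2\<close>, that is, logarithmic in
  \<open>T\<close>.\<close>

definition regret_const :: real where
  "regret_const = vbar * (lam_max + 1)\<^sup>2 / 2 + vbar * (1 + 2 * E0)\<^sup>2"

lemma grad_abs_le:
  assumes "k < T" "box p" shows "\<bar>grad k p\<bar> \<le> vbar * (1 + 2 * E0)"
proof -
  have "0 \<le> E0 * vbar" using E0_nonneg vbar_pos by simp
  then show ?thesis
    using est_cost_le[OF assms] est_cost_ge[OF assms] rho_pos rho_le
    by (auto simp: grad_def of_bool_def algebra_simps abs_le_iff)
qed

text \<open>Lets terms proportional to the step size telescope into \<open>sqrt\<close>.\<close>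

lemma sqrt_Suc_diff: "1 / (2 * sqrt (real (Suc k))) \<le> sqrt (real (Suc k)) - sqrt (real k)"
proof -
  have "(sqrt (real (Suc k)) - sqrt (real k)) * (sqrt (real (Suc k)) + sqrt (real k)) = 1"
    by (simp add: algebra_simps)
  moreover have "(sqrt (real (Suc k)) - sqrt (real k)) * (sqrt (real (Suc k)) + sqrt (real k))
     \<le> (sqrt (real (Suc k)) - sqrt (real k)) * (2 * sqrt (real (Suc k)))"
    by (intro mult_left_mono) auto
  ultimately show ?thesis by (simp add: divide_simps mult.commute)
qed

text \<open>The added potential is squared distance to \<open>u\<close> divided by twice the step
  size. A step changes it by the linear term of the regret, a squared gradient, and the effect of
  the shrinking step size. The sums start at 1 because the first round does not update the
  multiplier.\<close>

lemma ogd_regret_potential: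
  assumes p: "box p" and u: "0 \<le> u" "u \<le> 1"
  shows "k \<le> T \<Longrightarrow> (\<Sum>j\<in>{1..<k}. of_bool (alive j p) * grad j p * (u - lam (st j p)))
     + vbar * sqrt (real k) / 2 * (lam (st k p) - u)\<^sup>2 \<le> regret_const * sqrt (real k)"
proof (induction k)
  case 0
  then show ?case by simp
next
  case (Suc k)
  then have k: "k < T" by simp
  define l where "l = lam (st k p)"
  define s0 where "s0 = sqrt (real k)"
  define s where "s = sqrt (real (Suc k))"
  define S where "S = (\<Sum>j\<in>{1..<k}. of_bool (alive j p) * grad j p * (u - lam (st j p)))"
  have s: "0 < s" "s0 < s" "1 / (2 * s) \<le> s - s0"
    using sqrt_Suc_diff[of k] by (auto simp: s_def s0_def)
  have l: "0 \<le> l" "l \<le> lam_max" using lam_range[OF p, of k] k by (auto simp: l_def)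
  have IH: "S + vbar * s0 / 2 * (l - u)\<^sup>2 \<le> regret_const * s0"
    using Suc by (simp add: S_def l_def s0_def)
  have lu: "(l - u)\<^sup>2 \<le> (lam_max + 1)\<^sup>2" using l u by (intro abs_le_square_iff[THEN iffD1]) auto
  \<comment> \<open>Price of raising the weight of the potential from \<open>s0\<close> to
    \<open>s\<close>.\<close>
  have drift: "vbar * (s - s0) / 2 * (l - u)\<^sup>2 \<le> (s - s0) * (vbar * (lam_max + 1)\<^sup>2 / 2)"
    using mult_left_mono[OF lu, of "vbar * (s - s0) / 2"] s vbar_pos by (simp add: mult_ac)
  have c2: "0 \<le> (s - s0) * (vbar * (1 + 2 * E0)\<^sup>2)" using s vbar_pos by simp
  have rc: "regret_const * s = regret_const * s0 + (s - s0) * (vbar * (lam_max + 1)\<^sup>2 / 2)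
      + (s - s0) * (vbar * (1 + 2 * E0)\<^sup>2)"
    by (simp add: regret_const_def field_simps)
  have split: "vbar * s / 2 * (l - u)\<^sup>2 = vbar * s0 / 2 * (l - u)\<^sup>2 + vbar * (s - s0) / 2 * (l - u)\<^sup>2"
    by (simp add: field_simps)
  show ?case
  proof (cases "alive k p \<and> k \<noteq> 0")
    case True
    define g where "g = grad k p"
    define l' where "l' = lam (st (Suc k) p)"
    have l': "l' = max 0 (l + g / (vbar * s))"
      using True by (simp add: l'_def lam_Suc l_def g_def s_def)
    \<comment> \<open>Projection onto the nonnegative reals does not increase the distance to
      \<open>u\<close>, which is itself nonnegative.\<close>
    have "(l' - u)\<^sup>2 \<le> (l + g / (vbar * s) - u)\<^sup>2"
      unfolding l' using u by (intro abs_le_square_iff[THEN iffD1]) (auto simp: max_def)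
    then have "vbar * s / 2 * (l' - u)\<^sup>2 \<le> vbar * s / 2 * (l + g / (vbar * s) - u)\<^sup>2"
      using vbar_pos s by (intro mult_left_mono) auto
    also have "\<dots> = vbar * s / 2 * (l - u)\<^sup>2 + g * (l - u) + g\<^sup>2 / (2 * vbar * s)"
      using vbar_pos s by (simp add: power2_eq_square field_simps)
    finally have 1: "vbar * s / 2 * (l' - u)\<^sup>2 \<le> vbar * s / 2 * (l - u)\<^sup>2 + g * (l - u) + g\<^sup>2 / (2 * vbar * s)" .
    have "g\<^sup>2 \<le> (vbar * (1 + 2 * E0))\<^sup>2"
      using grad_abs_le[OF k p] by (intro abs_le_square_iff[THEN iffD1]) (auto simp: g_def)
    then have "g\<^sup>2 / (2 * vbar * s) \<le> (vbar * (1 + 2 * E0))\<^sup>2 / (2 * vbar * s)"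
      using vbar_pos s by (intro divide_right_mono) auto
    also have "\<dots> = 1 / (2 * s) * (vbar * (1 + 2 * E0)\<^sup>2)"
      using vbar_pos s by (simp add: power2_eq_square field_simps)
    also have "\<dots> \<le> (s - s0) * (vbar * (1 + 2 * E0)\<^sup>2)"
      using s vbar_pos by (intro mult_right_mono) auto
    finally have 2: "g\<^sup>2 / (2 * vbar * s) \<le> (s - s0) * (vbar * (1 + 2 * E0)\<^sup>2)" .
    have 3: "(\<Sum>j\<in>{1..<Suc k}. of_bool (alive j p) * grad j p * (u - lam (st j p))) = S + g * (u - l)"
      using True by (simp add: S_def g_def l_def)
    have "g * (u - l) + g * (l - u) = 0" by (simp add: algebra_simps)
    then show ?thesis
      unfolding 3 using 1 2 IH drift rc split by (simp only: l'_def[symmetric] s_def[symmetric])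
  next
    \<comment> \<open>First round or stopped run: the multiplier stays put and only the weight of
      the potential grows.\<close>
    case False
    have "(\<Sum>j\<in>{1..<Suc k}. of_bool (alive j p) * grad j p * (u - lam (st j p))) = S"
      using False by (cases "k = 0") (auto simp: S_def)
    moreover have "lam (st (Suc k) p) = l" using False by (auto simp: lam_Suc l_def)
    ultimately show ?thesis
      using IH drift rc c2 split by (simp only: s_def[symmetric])
  qed
qed

lemma ogd_regret:
  assumes p: "box p" and u: "0 \<le> u" "u \<le> 1"
  shows "u * (\<Sum>j\<in>{1..<T}. of_bool (alive j p) * grad j p) - regret_const * sqrt (real T)
     \<le> (\<Sum>j\<in>{1..<T}. of_bool (alive j p) * (lam (st j p) * grad j p))"
proof -
  have "0 \<le> vbar * sqrt (real T) / 2 * (lam (st T p) - u)\<^sup>2" using vbar_pos by simp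
  moreover have "(\<Sum>j\<in>{1..<T}. of_bool (alive j p) * grad j p * (u - lam (st j p)))
     = u * (\<Sum>j\<in>{1..<T}. of_bool (alive j p) * grad j p)
       - (\<Sum>j\<in>{1..<T}. of_bool (alive j p) * (lam (st j p) * grad j p))"
    unfolding sum_distrib_left sum_subtractf[symmetric] by (intro sum.cong) (auto simp: algebra_simps)
  ultimately show ?thesis using ogd_regret_potential[OF p u, of T] by linarith
qed

text \<open>The decision maximises \<open>z * (est_reward - lam * est_cost)\<close> over
  \<open>z\<close> in \<open>[0, 1]\<close>. Compare with \<open>z = q\<close>; since
  \<open>est_cost\<close> is at most \<open>vbar\<close>, the payment \<open>q * est_cost\<close> is
  at most \<open>\<rho>\<close>.\<close>

lemma play_lagrangian:
  assumes k: "k < T" "0 < k" and p: "box p" and a: "alive k p"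
  shows "\<rho> / vbar * est_reward k p + lam (st k p) * grad k p \<le> of_bool (play k p) * est_reward k p"
proof -
  define q where "q = \<rho> / vbar"
  have q: "0 < q" "q \<le> 1" "q * vbar = \<rho>" using vbar_pos rho_pos rho_le by (auto simp: q_def)
  let ?l = "lam (st k p)" and ?r = "est_reward k p" and ?c = "est_cost k p"
  have l: "0 \<le> ?l" using lam_range[OF p, of k] k by auto
  have "q * ?c \<le> q * vbar" using est_cost_le[OF k(1) p] q by (intro mult_left_mono) auto
  then have "q * ?c \<le> \<rho>" using q(3) by simp
  then have lc: "?l * (q * ?c) \<le> ?l * \<rho>" using l by (rule mult_left_mono)
  show ?thesis
  proof (cases "play k p")
    case True
    then have "0 \<le> (1 - q) * (?r - ?l * ?c)" using k q by (intro mult_nonneg_nonneg) (auto simp: play_def)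
    then show ?thesis using True lc by (simp add: grad_def q_def[symmetric] algebra_simps)
  next
    case False
    then have "q * ?r \<le> q * (?l * ?c)" using k a q by (intro mult_left_mono) (auto simp: play_def)
    then show ?thesis using False lc by (simp add: grad_def q_def[symmetric] algebra_simps)
  qed
qed

section \<open>Confidence bounds outside bad events and the sum of the widths\<close>

lemma plays_ge_1: "0 < k \<Longrightarrow> 1 \<le> plays k p"
  using plays_mono[of 1 k p] play_0 by (simp add: plays_def)

lemma dev_eq:
  assumes "0 < plays k p"
  shows "dev f m k p = plays k p * (avg f k p - m)"
proof -
  have "dev f m k p = (\<Sum>j<k. of_bool (play j p) * f (p (Suc j))) - plays k p * m"
    unfolding dev_def plays_def sum_distrib_right sum_subtractf[symmetric]
    by (intro sum.cong) (auto simp: algebra_simps)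
  then show ?thesis using assms by (simp add: avg_def algebra_simps)
qed

lemma not_bad:
  assumes "0 < k" "\<not> bad f k p"
  shows "avg f k p - (\<integral>y. f y \<partial>G) \<le> eps (plays k p) * V k"
proof -
  have n: "0 < plays k p" using plays_ge_1[OF assms(1), of p] by simp
  then have "plays k p * (avg f k p - (\<integral>y. f y \<partial>G)) \<le> plays k p * (eps (plays k p) * V k)"
    using assms(2) by (simp add: bad_def dev_eq mult.assoc)
  then show ?thesis using n by simp
qed

text \<open>Reward averages are controlled from below for optimism and from above to turn estimated
  gains into mean gains. Cost averages are controlled from below, so that low estimated spending
  implies low mean spending.\<close>

abbreviation bad_low :: "nat \<Rightarrow> (nat \<Rightarrow> real) \<Rightarrow> bool" where
  "bad_low k \<equiv> bad (\<lambda>y. - reward (V k) y) k"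
abbreviation bad_high :: "nat \<Rightarrow> (nat \<Rightarrow> real) \<Rightarrow> bool" where
  "bad_high k \<equiv> bad (reward (V k)) k"
abbreviation bad_cost :: "nat \<Rightarrow> (nat \<Rightarrow> real) \<Rightarrow> bool" where
  "bad_cost k \<equiv> bad (\<lambda>y. - cost (V k) y) k"

lemma avg_uminus: "avg (\<lambda>y. - f y) k p = - avg f k p"
  by (simp add: avg_def sum_negf del: sum_mult_of_bool_eq sum_of_bool_mult_eq)

text \<open>Off the bad event the bonus covers the deviation; on it, the trivial range of the mean
  costs at most \<open>vbar\<close>. The next two bounds pay for their bad events in the same
  way.\<close>

lemma est_reward_optimistic:
  assumes k: "k < T" "0 < k" and p: "box p"
  shows "mean_reward k \<le> est_reward k p + vbar * of_bool (bad_low k p)"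
proof (cases "bad_low k p")
  case True
  then show ?thesis
    using est_reward_nonneg[OF k(1) p] mean_reward_range[OF k(1)] V_range[OF k(1)] by simp
next
  case False
  then show ?thesis using not_bad[OF k(2) False]
    by (simp add: avg_uminus est_reward_eq mean_reward_def)
qed

text \<open>One width is the bonus in the estimate, the other the statistical error.\<close>

lemma est_reward_upper:
  assumes k: "k < T" "0 < k" and p: "box p"
  shows "est_reward k p \<le> mean_reward k + 2 * vbar * eps (plays k p) + vbar * of_bool (bad_high k p)"
proof (cases "bad_high k p")
  case True
  then show ?thesis
    using avg_reward_range[OF k(1) p] mean_reward_range[OF k(1)] V_range[OF k(1)] eps_V[OF k(1), of p]
    by (simp add: est_reward_eq mult.commute)
next
  case False
  then show ?thesis using not_bad[OF k(2) False] eps_V[OF k(1), of p]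
    by (simp add: est_reward_eq mean_reward_def mult.commute)
qed

text \<open>Two widths are the discount subtracted in the estimate, the third is the statistical
  error.\<close>

lemma est_cost_upper:
  assumes k: "k < T" "0 < k" and p: "box p"
  shows "mean_cost k \<le> est_cost k p + 3 * vbar * eps (plays k p) + vbar * of_bool (bad_cost k p)"
proof (cases "bad_cost k p")
  case True
  then show ?thesis
    using avg_cost_range[OF k(1) p] mean_cost_range[OF k(1)] V_range[OF k(1)] eps_V[OF k(1), of p]
    by (simp add: est_cost_eq mult.commute)
next
  case False
  then show ?thesis using not_bad[OF k(2) False] eps_V[OF k(1), of p]
    by (simp add: avg_uminus est_cost_eq mean_cost_def mult.commute)
qed

text \<open>Each summed round adds an observation, so the widths run through
  \<open>E0 / sqrt n\<close> with distinct \<open>n\<close> and telescope.\<close>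

lemma sum_eps_le:
  "0 < k \<Longrightarrow> (\<Sum>j\<in>{1..<k}. of_bool (play j p) * eps (plays j p)) \<le> 3 * E0 * sqrt (plays k p)"
proof (induction k)
  case (Suc k)
  show ?case
  proof (cases "k = 0 \<or> \<not> play k p")
    case True
    then show ?thesis
      using Suc E0_nonneg plays_nonneg[of "Suc k" p] by (cases "k = 0") (auto simp: plays_def)
  next
    case False
    then have k: "0 < k" and pl: "play k p" by auto
    define n where "n = plays k p"
    have n: "1 \<le> n" using plays_ge_1[OF k] by (simp add: n_def)
    \<comment> \<open>This crude bound gives \<open>sqrt (n + 1) + sqrt n <= 3 * sqrt n\<close>, the
      source of the constant 3.\<close>
    have "sqrt (n + 1) \<le> sqrt (4 * n)" using n by (intro real_sqrt_le_mono) auto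
    then have "sqrt (n + 1) \<le> 2 * sqrt n" by (simp add: real_sqrt_mult)
    define d where "d = sqrt (n + 1) - sqrt n"
    have "d * (sqrt (n + 1) + sqrt n) \<le> d * (3 * sqrt n)"
      using \<open>sqrt (n + 1) \<le> 2 * sqrt n\<close> by (intro mult_left_mono) (auto simp: d_def)
    moreover have "d * (sqrt (n + 1) + sqrt n) = 1"
      using n by (simp add: d_def algebra_simps)
    ultimately have "1 / sqrt n \<le> 3 * d"
      using n by (simp add: divide_simps mult_ac)
    then have "E0 * (1 / sqrt n) \<le> E0 * (3 * d)"
      using E0_nonneg by (rule mult_left_mono)
    then have "eps n \<le> 3 * E0 * sqrt (n + 1) - 3 * E0 * sqrt n"
      by (simp add: eps_eq d_def algebra_simps)
    moreover have "plays (Suc k) p = n + 1" using pl by (simp add: plays_def n_def)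
    moreover have "(\<Sum>j\<in>{1..<Suc k}. of_bool (play j p) * eps (plays j p))
        = (\<Sum>j\<in>{1..<k}. of_bool (play j p) * eps (plays j p)) + eps n"
      using k pl by (simp add: n_def del: sum_mult_of_bool_eq sum_of_bool_mult_eq)
    ultimately show ?thesis using Suc.IH[OF k] by (simp only: n_def[symmetric])
  qed
qed simp

section \<open>Accounting for budget, revenue and stopping\<close>

lemma plays_le: "plays k p \<le> real k"
  using plays_nat[of k p] by auto

lemma budget_eq: "budget (st k p) = \<rho> * real T - (\<Sum>j<k. of_bool (play j p) * cost (V j) (p (Suc j)))"
proof (induction k)
  case (Suc k)
  then show ?case using play_alive[of k p]
    by (auto simp: st_Suc algebra_simps simp del: sum_mult_of_bool_eq sum_of_bool_mult_eq)
qed (simp add: st_0)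

lemma rev_eq: "rev (st k p) = (\<Sum>j<k. of_bool (play j p) * reward (V j) (p (Suc j)))"
proof (induction k)
  case (Suc k)
  then show ?case using play_alive[of k p]
    by (auto simp: st_Suc simp del: sum_mult_of_bool_eq sum_of_bool_mult_eq)
qed (simp add: st_0)

lemma stopped_budget: "\<not> alive k p \<Longrightarrow> budget (st k p) < vbar"
  by (induction k) (auto simp: st_0 st_Suc alive_def split: if_splits)

lemma alive_mono: "j \<le> k \<Longrightarrow> alive k p \<Longrightarrow> alive j p"
proof (induction k)
  case (Suc k)
  have "alive (Suc k) p \<Longrightarrow> alive k p" by (auto simp: alive_def st_Suc split: if_splits)
  then show ?case using Suc by (cases "j = Suc k") auto
qed simp

end

section \<open>Expected loss\<close>

context ogd_cb
begin

text \<open>Martingale difference between actual payments and their conditional means.\<close>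

definition noise :: "(nat \<Rightarrow> real) \<Rightarrow> real" where
  "noise p = (\<Sum>j<T. of_bool (play j p) * (cost (V j) (p (Suc j)) - mean_cost j))"

definition bad_count :: "(nat \<Rightarrow> real) \<Rightarrow> real" where
  "bad_count p = (\<Sum>j\<in>{1..<T}. of_bool (bad_low j p) + of_bool (bad_high j p) + of_bool (bad_cost j p))"

text \<open>\<open>\<rho>\<close> is the comparator's share of the first round;
  \<open>2 * vbar\<close> covers the budget left at stopping and the first payment; 15 is 3 from
  \<open>sum_eps_le\<close> times the 2 reward widths plus 3 cost widths per play.\<close>

definition det_loss :: real where
  "det_loss = \<rho> + 2 * vbar + 15 * vbar * E0 * sqrt (real T) + regret_const * sqrt (real T)"

lemma sum_split_first: "(\<Sum>j<T. f j) = f 0 + (\<Sum>j\<in>{1..<T}. f j :: real)"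
proof -
  have "{..<T} = insert 0 {1..<T}" using T_pos by auto
  then show ?thesis by simp
qed

text \<open>Comparator multiplier: 1 if the budget ran out, so that the overspending pays for the
  rounds lost after stopping; 0 otherwise.\<close>

lemma stopping_loss_le_dual:
  assumes p: "box p"
  shows "\<exists>u\<in>{0..1}. \<rho> * (\<Sum>j\<in>{1..<T}. 1 - of_bool (alive j p)) - 2 * vbar - \<bar>noise p\<bar>
      - (\<Sum>j\<in>{1..<T}. 3 * vbar * (of_bool (play j p) * eps (plays j p)) + vbar * of_bool (bad_cost j p))
    \<le> u * (\<Sum>j\<in>{1..<T}. of_bool (alive j p) * grad j p)"
proof -
  note [simp del] = sum_mult_of_bool_eq sum_of_bool_mult_eq sum_of_bool_eq
  define C where "C = (\<Sum>j\<in>{1..<T}. 3 * vbar * (of_bool (play j p) * eps (plays j p)) + vbar * of_bool (bad_cost j p))"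
  have C0: "0 \<le> C" unfolding C_def using vbar_pos eps_plays(1) by (intro sum_nonneg) auto
  show ?thesis
  proof (cases "alive T p")
    case True
    then have "alive j p" if "j \<in> {1..<T}" for j using alive_mono[of j T p] that by auto
    then have "(\<Sum>j\<in>{1..<T}. 1 - of_bool (alive j p)) = (0 :: real)" by (intro sum.neutral) auto
    then show ?thesis using C0 vbar_pos by (intro bexI[of _ 0]) (auto simp: C_def)
  next
    case False
    \<comment> \<open>A stopped run has less than \<open>vbar\<close> of its budget left.\<close>
    have spent: "\<rho> * real T - vbar \<le> (\<Sum>j<T. of_bool (play j p) * cost (V j) (p (Suc j)))"
      using stopped_budget[OF False] by (simp add: budget_eq)
    have "noise p = (\<Sum>j<T. of_bool (play j p) * cost (V j) (p (Suc j))) - (\<Sum>j<T. of_bool (play j p) * mean_cost j)"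
      unfolding noise_def sum_subtractf[symmetric] by (intro sum.cong) (auto simp: algebra_simps)
    moreover have "(\<Sum>j<T. of_bool (play j p) * mean_cost j) \<le> vbar + (\<Sum>j\<in>{1..<T}. of_bool (play j p) * mean_cost j)"
      unfolding sum_split_first using mean_cost_range[of 0] V_range[of 0] T_pos by (simp add: play_0)
    moreover have "(\<Sum>j\<in>{1..<T}. of_bool (play j p) * mean_cost j)
        \<le> (\<Sum>j\<in>{1..<T}. of_bool (play j p) * est_cost j p
          + (3 * vbar * (of_bool (play j p) * eps (plays j p)) + vbar * of_bool (bad_cost j p)))"
    proof (rule sum_mono)
      fix j assume "j \<in> {1..<T}"
      then have "mean_cost j \<le> est_cost j p + 3 * vbar * eps (plays j p) + vbar * of_bool (bad_cost j p)"
        by (intro est_cost_upper p) auto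
      then show "of_bool (play j p) * mean_cost j \<le> of_bool (play j p) * est_cost j p
          + (3 * vbar * (of_bool (play j p) * eps (plays j p)) + vbar * of_bool (bad_cost j p))"
        using vbar_pos by (cases "play j p") auto
    qed
    moreover have "(\<Sum>j\<in>{1..<T}. of_bool (play j p) * est_cost j p
          + (3 * vbar * (of_bool (play j p) * eps (plays j p)) + vbar * of_bool (bad_cost j p)))
        = (\<Sum>j\<in>{1..<T}. of_bool (play j p) * est_cost j p) + C"
      by (simp add: sum.distrib C_def)
    \<comment> \<open>After stopping \<open>grad\<close> is \<open>- \<rho>\<close>; masking it
      leaves a surplus of \<open>\<rho>\<close> for every lost round.\<close>
    moreover have "(\<Sum>j\<in>{1..<T}. of_bool (alive j p) * grad j p)
        = (\<Sum>j\<in>{1..<T}. of_bool (play j p) * est_cost j p - \<rho> + \<rho> * (1 - of_bool (alive j p)))"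
      using play_alive by (intro sum.cong) (auto simp: grad_def of_bool_def)
    moreover have "\<dots> = (\<Sum>j\<in>{1..<T}. of_bool (play j p) * est_cost j p) - \<rho> * real (T - 1)
        + \<rho> * (\<Sum>j\<in>{1..<T}. 1 - of_bool (alive j p))"
      by (simp add: sum.distrib sum_subtractf sum_distrib_left right_diff_distrib)
    moreover have "\<rho> * real (T - 1) \<le> \<rho> * real T" using rho_pos by (intro mult_left_mono) auto
    ultimately show ?thesis
      using spent unfolding C_def[symmetric] by (intro bexI[of _ 1]) simp_all
  qed
qed

text \<open>Sums the one-round comparison. The surplus from \<open>stopping_loss_le_dual\<close>
  cancels the comparator's reward in stopped rounds, at most \<open>q * vbar = \<rho>\<close>
  each.\<close>

lemma pathwise_bound:
  assumes p: "box p"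
  shows "\<rho> / vbar * (\<Sum>j<T. mean_reward j) - det_loss - \<bar>noise p\<bar> - vbar * bad_count p
    \<le> (\<Sum>j<T. of_bool (play j p) * mean_reward j)"
proof -
  note [simp del] = sum_mult_of_bool_eq sum_of_bool_mult_eq sum_of_bool_eq
  define q where "q = \<rho> / vbar"
  have q: "0 < q" "q \<le> 1" "q * vbar = \<rho>" using vbar_pos rho_pos rho_le by (auto simp: q_def)
  let ?x = "\<lambda>j. of_bool (play j p) :: real" and ?a = "\<lambda>j. of_bool (alive j p) :: real"
  let ?e = "\<lambda>j. ?x j * eps (plays j p)"
  have lagr: "q * (?a j * mean_reward j) + ?a j * (lam (st j p) * grad j p)
      \<le> ?x j * mean_reward j + 2 * vbar * ?e j + vbar * of_bool (bad_low j p) + vbar * of_bool (bad_high j p)"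
    if "j \<in> {1..<T}" for j
  proof (cases "alive j p")
    case True
    have j: "j < T" "0 < j" using that by auto
    have "q * est_reward j p + lam (st j p) * grad j p \<le> ?x j * est_reward j p"
      using play_lagrangian[OF j p True] by (simp add: q_def)
    moreover have "?x j * est_reward j p \<le> ?x j * mean_reward j + 2 * vbar * ?e j + vbar * of_bool (bad_high j p)"
      using est_reward_upper[OF j p] vbar_pos by (cases "play j p") auto
    moreover have "q * mean_reward j \<le> q * est_reward j p + vbar * of_bool (bad_low j p)"
    proof -
      have "q * mean_reward j \<le> q * (est_reward j p + vbar * of_bool (bad_low j p))"
        using q est_reward_optimistic[OF j p] by (intro mult_left_mono) auto
      also have "\<dots> = q * est_reward j p + q * (vbar * of_bool (bad_low j p))" by (rule distrib_left)
      also have "q * (vbar * of_bool (bad_low j p)) \<le> 1 * (vbar * of_bool (bad_low j p))"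
        using q vbar_pos by (intro mult_right_mono) auto
      finally show ?thesis by simp
    qed
    ultimately show ?thesis using True by simp
  next
    case False
    then have "\<not> play j p" using play_alive by blast
    then show ?thesis using False vbar_pos by auto
  qed
  have "q * (\<Sum>j\<in>{1..<T}. ?a j * mean_reward j) + (\<Sum>j\<in>{1..<T}. ?a j * (lam (st j p) * grad j p))
      \<le> (\<Sum>j\<in>{1..<T}. ?x j * mean_reward j) + 2 * vbar * (\<Sum>j\<in>{1..<T}. ?e j)
        + vbar * (\<Sum>j\<in>{1..<T}. of_bool (bad_low j p)) + vbar * (\<Sum>j\<in>{1..<T}. of_bool (bad_high j p))"
    using sum_mono[of "{1..<T}", OF lagr] by (simp add: sum.distrib sum_distrib_left mult.assoc)
  moreover obtain u where u: "0 \<le> u" "u \<le> 1"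
    and ub: "\<rho> * (\<Sum>j\<in>{1..<T}. 1 - ?a j) - 2 * vbar - \<bar>noise p\<bar>
      - (\<Sum>j\<in>{1..<T}. 3 * vbar * ?e j + vbar * of_bool (bad_cost j p))
      \<le> u * (\<Sum>j\<in>{1..<T}. ?a j * grad j p)"
    using stopping_loss_le_dual[OF p] by auto
  moreover note ogd_regret[OF p u]
  moreover have "(\<Sum>j\<in>{1..<T}. 3 * vbar * ?e j + vbar * of_bool (bad_cost j p))
      = 3 * vbar * (\<Sum>j\<in>{1..<T}. ?e j) + vbar * (\<Sum>j\<in>{1..<T}. of_bool (bad_cost j p))"
    by (simp add: sum.distrib sum_distrib_left mult.assoc)
  \<comment> \<open>Bounds the comparator by \<open>vbar\<close> in the first round and in every
    stopped round, where play cannot match it.\<close>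
  moreover have "q * (\<Sum>j<T. mean_reward j) \<le> \<rho> + \<rho> * (\<Sum>j\<in>{1..<T}. 1 - ?a j)
      + q * (\<Sum>j\<in>{1..<T}. ?a j * mean_reward j)"
  proof -
    have mr: "mean_reward j \<le> vbar" if "j < T" for j
      using mean_reward_range[OF that] V_range[OF that] by linarith
    have "(\<Sum>j\<in>{1..<T}. mean_reward j) \<le> (\<Sum>j\<in>{1..<T}. vbar * (1 - ?a j) + ?a j * mean_reward j)"
      using mr by (intro sum_mono) (auto simp: of_bool_def)
    then have "(\<Sum>j<T. mean_reward j) \<le> vbar + (\<Sum>j\<in>{1..<T}. vbar * (1 - ?a j) + ?a j * mean_reward j)"
      using mr[OF T_pos] by (simp add: sum_split_first)
    then have "q * (\<Sum>j<T. mean_reward j)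
        \<le> q * (vbar + (\<Sum>j\<in>{1..<T}. vbar * (1 - ?a j) + ?a j * mean_reward j))"
      using q by (intro mult_left_mono) auto
    also have "\<dots> = q * vbar + q * vbar * (\<Sum>j\<in>{1..<T}. 1 - ?a j) + q * (\<Sum>j\<in>{1..<T}. ?a j * mean_reward j)"
      unfolding sum.distrib sum_distrib_left[symmetric] by (simp add: algebra_simps)
    finally show ?thesis unfolding q(3) .
  qed
  moreover have "(\<Sum>j\<in>{1..<T}. ?x j * mean_reward j) \<le> (\<Sum>j<T. ?x j * mean_reward j)"
    using mean_reward_range(1) by (intro sum_mono2) auto
  moreover have "5 * vbar * (\<Sum>j\<in>{1..<T}. ?e j) \<le> 15 * vbar * E0 * sqrt (real T)"
  proof -
    have "(\<Sum>j\<in>{1..<T}. ?e j) \<le> 3 * E0 * sqrt (plays T p)" by (rule sum_eps_le[OF T_pos])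
    also have "\<dots> \<le> 3 * E0 * sqrt (real T)"
      using plays_le E0_nonneg by (intro mult_left_mono real_sqrt_le_mono) auto
    finally have "5 * vbar * (\<Sum>j\<in>{1..<T}. ?e j) \<le> 5 * vbar * (3 * E0 * sqrt (real T))"
      using vbar_pos by (intro mult_left_mono) auto
    then show ?thesis by (simp add: mult_ac)
  qed
  moreover have "vbar * bad_count p = vbar * (\<Sum>j\<in>{1..<T}. of_bool (bad_low j p))
      + vbar * (\<Sum>j\<in>{1..<T}. of_bool (bad_high j p)) + vbar * (\<Sum>j\<in>{1..<T}. of_bool (bad_cost j p))"
    unfolding bad_count_def sum.distrib by (simp add: distrib_left)
  ultimately show ?thesis unfolding det_loss_def q_def[symmetric] by linarith
qed

lemma noise_bound: "integrable M noise" "(\<integral>p. \<bar>noise p\<bar> \<partial>M) \<le> vbar * sqrt (real T)"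
proof -
  have f: "(\<lambda>y. cost (V j) y - mean_cost j) \<in> borel_measurable borel" for j by measurable
  have b: "AE y in G. \<bar>cost (V j) y - mean_cost j\<bar> \<le> vbar" if j: "j < T" for j
    using AE_cost[OF j] by eventually_elim (use mean_cost_range[OF j] V_range[OF j] in auto)
  have m: "(\<integral>y. cost (V j) y - mean_cost j \<partial>G) = 0" if "j < T" for j
    using integrable_cost[OF that] by (simp add: mean_cost_def G.prob_space)
  show "integrable M noise" "(\<integral>p. \<bar>noise p\<bar> \<partial>M) \<le> vbar * sqrt (real T)"
    unfolding noise_def[abs_def] by (rule expectation_abs_le[OF f b vbar_pos m]; assumption)+
qed

lemma integrable_of_bool: "Measurable.pred M P \<Longrightarrow> integrable M (\<lambda>p. of_bool (P p) :: real)"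
  by (rule M.integrable_const_bound[of _ 1]) (auto simp: of_bool_def)

lemma bad_count_bound: "integrable M bad_count" "(\<integral>p. bad_count p \<partial>M) \<le> 3 / 2"
proof -
  have int: "integrable M (\<lambda>p. of_bool (bad f j p) :: real)"
    if "j < T" "f \<in> borel_measurable borel" for f j
    using that by (intro integrable_of_bool bad_measurable) auto
  have lo: "(\<integral>p. of_bool (bad_low j p) \<partial>M) \<le> 1 / (2 * real T)" if j: "j < T" for j
  proof (rule expectation_bad[OF j, of _ "- V j" 0])
    show "AE y in G. - reward (V j) y \<in> {- V j..0}" using AE_reward[OF j] by eventually_elim auto
  qed auto
  have hi: "(\<integral>p. of_bool (bad_high j p) \<partial>M) \<le> 1 / (2 * real T)" if j: "j < T" for j
  proof (rule expectation_bad[OF j, of _ 0 "V j"])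
    show "AE y in G. reward (V j) y \<in> {0..V j}" using AE_reward[OF j] by eventually_elim auto
  qed auto
  have co: "(\<integral>p. of_bool (bad_cost j p) \<partial>M) \<le> 1 / (2 * real T)" if j: "j < T" for j
  proof (rule expectation_bad[OF j, of _ "- V j" 0])
    show "AE y in G. - cost (V j) y \<in> {- V j..0}" using AE_cost[OF j] by eventually_elim auto
  qed auto
  show "integrable M bad_count"
    unfolding bad_count_def[abs_def] by (intro Bochner_Integration.integrable_sum
      Bochner_Integration.integrable_add int) auto
  have "(\<integral>p. bad_count p \<partial>M) = (\<Sum>j\<in>{1..<T}. (\<integral>p. of_bool (bad_low j p) \<partial>M)
      + (\<integral>p. of_bool (bad_high j p) \<partial>M) + (\<integral>p. of_bool (bad_cost j p) \<partial>M))"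
    unfolding bad_count_def
    by (simp add: int)
  also have "\<dots> \<le> (\<Sum>j\<in>{1..<T}. 1 / (2 * real T) + 1 / (2 * real T) + 1 / (2 * real T))"
    by (intro sum_mono add_mono lo hi co) auto
  also have "\<dots> \<le> real T * (3 / (2 * real T))"
    by (simp add: field_simps)
  finally show "(\<integral>p. bad_count p \<partial>M) \<le> 3 / 2" using T_pos by simp
qed

section \<open>Passage from the pathwise bound to expectations\<close>

definition total_loss :: real where
  "total_loss = det_loss + vbar * sqrt (real T) + 3 / 2 * vbar"

text \<open>The decision does not see the bid of its own round, so inside the expectation the reward
  may be replaced by its mean.\<close>

lemma expectation_reward:
  assumes j: "j < T"
  shows "integrable M (\<lambda>p. reward (V j) (p (Suc j)))"
    "(\<integral>p. reward (V j) (p (Suc j)) \<partial>M) = mean_reward j"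
    "integrable M (\<lambda>p. of_bool (play j p) * reward (V j) (p (Suc j)))"
    "(\<integral>p. of_bool (play j p) * reward (V j) (p (Suc j)) \<partial>M) = (\<integral>p. of_bool (play j p) * mean_reward j \<partial>M)"
proof -
  note [simp del] = sum_mult_of_bool_eq sum_of_bool_mult_eq sum_of_bool_eq
  have [measurable]: "(\<lambda>p. p (Suc j)) \<in> borel_measurable M" "Measurable.pred M (play j)" using j by auto
  have ae: "AE p in M. 0 \<le> reward (V j) (p (Suc j)) \<and> reward (V j) (p (Suc j)) \<le> V j"
    using AE_reward[OF j] j by (intro AE_bid) auto
  show i1: "integrable M (\<lambda>p. reward (V j) (p (Suc j)))"
  proof (rule M.integrable_const_bound[of _ "V j"])
    show "AE p in M. norm (reward (V j) (p (Suc j))) \<le> V j" using ae by eventually_elim auto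
  qed measurable
  show i2: "integrable M (\<lambda>p. of_bool (play j p) * reward (V j) (p (Suc j)))"
  proof (rule M.integrable_const_bound[of _ "V j"])
    show "AE p in M. norm (of_bool (play j p) * reward (V j) (p (Suc j))) \<le> V j"
      using ae by eventually_elim (auto simp: of_bool_def)
  qed measurable
  show "(\<integral>p. reward (V j) (p (Suc j)) \<partial>M) = mean_reward j"
    using integral_predictable_mult[of "Suc j" "\<lambda>_. 1" "reward (V j)"] i1 j
    by (simp add: mean_reward_def M.prob_space)
  show "(\<integral>p. of_bool (play j p) * reward (V j) (p (Suc j)) \<partial>M) = (\<integral>p. of_bool (play j p) * mean_reward j \<partial>M)"
    using integral_predictable_mult[of "Suc j" "\<lambda>p. of_bool (play j p)" "reward (V j)"] i2 j
      integrable_of_bool[of "play j"]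
    by (simp add: mean_reward_def play_predictable)
qed

lemma total_loss_nonneg: "0 \<le> total_loss"
  unfolding total_loss_def det_loss_def regret_const_def
  using vbar_pos rho_pos E0_nonneg by (intro add_nonneg_nonneg mult_nonneg_nonneg) auto

text \<open>If the integrand were not integrable, its integral would be 0, so measurability of the
  hindsight optimum is not an issue.\<close>

lemma normalized_gap_ge: "- (total_loss / real T) \<le> normalized_gap vbar \<rho> T v G"
proof -
  note [simp del] = sum_mult_of_bool_eq sum_of_bool_mult_eq sum_of_bool_eq
  define F where "F p = ogd_revenue vbar \<rho> T v p - \<rho> / vbar * hindsight \<rho> T v p" for p
  \<comment> \<open>Minorant of \<open>F\<close> with the relaxed benchmark; unlike for
    \<open>F\<close>, its integrability follows directly from that of the single rewards.\<close>
  define H where "H p = (\<Sum>j<T. of_bool (play j p) * reward (V j) (p (Suc j)))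
    - \<rho> / vbar * (\<Sum>j<T. reward (V j) (p (Suc j)))" for p
  have "- total_loss \<le> (\<integral>p. F p \<partial>M)"
  proof (cases "integrable M F")
    case True
    have iH: "integrable M H" unfolding H_def
      by (intro Bochner_Integration.integrable_diff integrable_mult_right
          Bochner_Integration.integrable_sum) (auto intro: expectation_reward)
    have HF: "H p \<le> F p" for p
    proof -
      have "hindsight \<rho> T v p \<le> (\<Sum>t\<in>{1..T}. reward (v t) (p t))"
        using rho_pos by (intro hindsight_le_sum_reward) auto
      also have "\<dots> = (\<Sum>j<T. reward (V j) (p (Suc j)))"
        by (rule sum.reindex_bij_witness[of _ Suc "\<lambda>t. t - 1"]) auto
      finally have "\<rho> / vbar * hindsight \<rho> T v p \<le> \<rho> / vbar * (\<Sum>j<T. reward (V j) (p (Suc j)))"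
        using rho_pos vbar_pos by (intro mult_left_mono) auto
      then show ?thesis
        using rev_eq[of T p] by (simp add: F_def H_def ogd_revenue_def st_def)
    qed
    have "(\<integral>p. H p \<partial>M) = (\<Sum>j<T. (\<integral>p. of_bool (play j p) * mean_reward j \<partial>M))
        - \<rho> / vbar * (\<Sum>j<T. mean_reward j)"
      unfolding H_def by (subst Bochner_Integration.integral_diff)
        (auto simp: expectation_reward Bochner_Integration.integral_sum
          intro!: Bochner_Integration.integrable_sum integrable_divide integrable_mult_right expectation_reward)
    moreover have "(\<Sum>j<T. (\<integral>p. of_bool (play j p) * mean_reward j \<partial>M))
        = (\<integral>p. (\<Sum>j<T. of_bool (play j p) * mean_reward j) \<partial>M)"
      by (rule Bochner_Integration.integral_sum[symmetric]) (auto intro!: integrable_of_bool)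
    moreover have "(\<integral>p. \<rho> / vbar * (\<Sum>j<T. mean_reward j) - det_loss - \<bar>noise p\<bar> - vbar * bad_count p \<partial>M)
        \<le> (\<integral>p. (\<Sum>j<T. of_bool (play j p) * mean_reward j) \<partial>M)"
    proof (rule integral_mono_AE)
      show "AE p in M. \<rho> / vbar * (\<Sum>j<T. mean_reward j) - det_loss - \<bar>noise p\<bar> - vbar * bad_count p
          \<le> (\<Sum>j<T. of_bool (play j p) * mean_reward j)"
        using AE_box by eventually_elim (rule pathwise_bound)
      show "integrable M (\<lambda>p. \<rho> / vbar * (\<Sum>j<T. mean_reward j) - det_loss - \<bar>noise p\<bar> - vbar * bad_count p)"
        by (intro Bochner_Integration.integrable_diff integrable_abs integrable_mult_right
            noise_bound bad_count_bound M.integrable_const)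
      show "integrable M (\<lambda>p. \<Sum>j<T. of_bool (play j p) * mean_reward j)"
        by (intro Bochner_Integration.integrable_sum integrable_mult_left integrable_of_bool x_measurable) simp
    qed
    moreover have "(\<integral>p. \<rho> / vbar * (\<Sum>j<T. mean_reward j) - det_loss - \<bar>noise p\<bar> - vbar * bad_count p \<partial>M)
        = \<rho> / vbar * (\<Sum>j<T. mean_reward j) - det_loss - (\<integral>p. \<bar>noise p\<bar> \<partial>M) - vbar * (\<integral>p. bad_count p \<partial>M)"
      using noise_bound(1) bad_count_bound(1) by (simp add: M.prob_space)
    ultimately have "- det_loss - (\<integral>p. \<bar>noise p\<bar> \<partial>M) - vbar * (\<integral>p. bad_count p \<partial>M) \<le> (\<integral>p. H p \<partial>M)"
      by linarith
    moreover have "vbar * (\<integral>p. bad_count p \<partial>M) \<le> vbar * (3 / 2)"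
      using vbar_pos bad_count_bound(2) by (intro mult_left_mono) auto
    moreover have "(\<integral>p. H p \<partial>M) \<le> (\<integral>p. F p \<partial>M)"
      by (intro integral_mono iH True HF)
    ultimately show ?thesis using noise_bound(2) unfolding total_loss_def by linarith
  next
    case False
    then show ?thesis using total_loss_nonneg by (simp add: not_integrable_integral_eq)
  qed
  then have "- total_loss / real T \<le> (\<integral>p. F p \<partial>M) / real T"
    by (intro divide_right_mono) auto
  then show ?thesis by (simp add: normalized_gap_def F_def M_def)
qed

end

section \<open>Uniform rate and limit inferior\<close>

definition loss_rate :: "real \<Rightarrow> real \<Rightarrow> nat \<Rightarrow> real" where
  "loss_rate vbar \<rho> T = (let E = sqrt ((ln 2 + 2 * ln (real T)) / 2) in
     (\<rho> + 2 * vbar + 15 * vbar * E * sqrt (real T)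
      + (vbar * (vbar * (1 + E) / \<rho> + 1 + 1)\<^sup>2 / 2 + vbar * (1 + 2 * E)\<^sup>2) * sqrt (real T)
      + vbar * sqrt (real T) + 3 / 2 * vbar) / real T)"

text \<open>\<open>E\<close> grows like \<open>sqrt (ln T)\<close> and enters at most quadratically,
  so the rate is of order \<open>ln T / sqrt T\<close>.\<close>

lemma loss_rate_tendsto_0:
  assumes "0 < vbar" "0 < \<rho>"
  shows "(\<lambda>T. loss_rate vbar \<rho> T) \<longlonglongrightarrow> 0"
  unfolding loss_rate_def Let_def using assms by real_asymp

theorem theorem7:
  fixes vbar \<rho> :: real
  assumes "0 < vbar" and "0 < \<rho>" and "\<rho> \<le> vbar"
  shows "liminf (\<lambda>T::nat. INF vG \<in> {(v, G). admissible vbar T v G}.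
                   ereal (normalized_gap vbar \<rho> T (fst vG) (snd vG))) \<ge> 0"
proof -
  \<comment> \<open>The rate involves neither \<open>v\<close> nor \<open>G\<close>, so a single
    bound passes to the infimum over all admissible pairs.\<close>
  have gap: "ereal (- loss_rate vbar \<rho> T) \<le> (INF vG \<in> {(v, G). admissible vbar T v G}.
      ereal (normalized_gap vbar \<rho> T (fst vG) (snd vG)))" if T: "0 < T" for T
  proof (rule INF_greatest)
    fix vG assume "vG \<in> {(v, G). admissible vbar T v G}"
    then obtain v G where vG: "vG = (v, G)" and adm: "admissible vbar T v G" by auto
    interpret G: prob_space G using adm by (simp add: admissible_def)
    have "AE y in G. y \<in> {0..vbar}"
    proof -
      have "space G = UNIV" using adm sets_eq_imp_space_eq[of G borel] by (simp add: admissible_def)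
      then have "{y \<in> space G. y \<in> {0..vbar}} = {0..vbar}" by auto
      then show ?thesis
        using adm by (subst G.AE_iff_emeasure_eq_1) (auto simp: admissible_def)
    qed
    then interpret ogd_cb G T vbar \<rho> v
      using adm assms T by unfold_locales (auto simp: admissible_def)
    show "ereal (- loss_rate vbar \<rho> T) \<le> ereal (normalized_gap vbar \<rho> T (fst vG) (snd vG))"
      using normalized_gap_ge
      by (simp add: vG loss_rate_def Let_def total_loss_def det_loss_def regret_const_def lam_max_def E0_def)
  qed
  have "(\<lambda>T. ereal (- loss_rate vbar \<rho> T)) \<longlonglongrightarrow> ereal (- 0)"
    using loss_rate_tendsto_0[OF assms(1,2)] by (intro tendsto_intros)
  then have "liminf (\<lambda>T. ereal (- loss_rate vbar \<rho> T)) = ereal (- 0)"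
    by (rule lim_imp_Liminf[OF sequentially_bot])
  then have "0 = liminf (\<lambda>T. ereal (- loss_rate vbar \<rho> T))"
    by (simp add: zero_ereal_def)
  also have "\<dots> \<le> liminf (\<lambda>T. INF vG \<in> {(v, G). admissible vbar T v G}.
      ereal (normalized_gap vbar \<rho> T (fst vG) (snd vG)))"
    by (intro Liminf_mono eventually_mono[OF eventually_gt_at_top[of 0]] gap)
  finally show ?thesis .
qed

end
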